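(* Let $\overrightarrow{\mathcal G}$ be an acyclic orientation of a generically $d$-rigid graph $\mathcal G$ on $n\ge d$ vertices. Then the following are equivalent: (a) $\overrightarrow{\mathcal G}$ is weakly admissible; (b) $\overrightarrow{\mathcal G}$ is admissible; (c) $\overrightarrow{\mathcal G}$ is strongly admissible; (d) for every generic target configuration $p^*$, the map $-Z(p^* )|_{\operatorname{im}R(p^* )}$ is Hurwitz, i.e. all eigenvalues of $Z(p^* )|_{\operatorname{im}R(p^* )}$ have positive real part.
   Context: Fix $d\ge1$ and a finite simple graph $\mathcal G=(\mathcal V,\mathcal E)$ with $\mathcal V=\{1,\dots,n\}$. A configuration is $p=(p_1,\dots,p_n)\in\mathbb R^{dn}$, $p_i\in\mathbb R^d$. Distance map: $F(p)=(\|p_j-p_i\|^2)_{ij\in\mathcal E}$. The rigidity matrix $R(p)\in\mathbb R^{|\mathcal E|\times dn}$ has, in the row of edge $ij$, the block $(p_i-p_j)^\top$ at vertex $i$, $(p_j-p_i)^\top$ at vertex $j$, and zeros elsewhere. $\mathcal G$ is generically $d$-rigid if for generic $p$ every $q$ sufficiently close to $p$ with $F(q)=F(p)$ is congruent to $p$ (differs by a Euclidean isometry). An orientation $\overrightarrow{\mathcal G}$ of $\mathcal G$ chooses for each edge a direction; it is acyclic if it has no directed cycle. $\overrightarrow R(p)$ is obtained from $R(p)$ by zeroing out, in the row of each edge, the block of the head: for $\overrightarrow{ij}$ (tail $i$, head $j$) only the block $(p_i-p_j)^\top$ at $i$ is kept. The directed controller $\dot p=-\overrightarrow R(p)^\top(F(p)-m^*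 )$ has edge operator $\eta_{(p,F(p))}=Z(p)=2R(p)\overrightarrow R(p)^\top$, whose image lies in $\operatorname{im}R(p)$; for regular $p$, $\operatorname{im}R(p)=T_{F(p)}\mathcal Q$, where $\mathcal Q$ is the manifold of regular values of $F$. "For every generic $p$" means: for all $p$ outside some proper algebraic subset of $\mathbb R^{dn}$ defined over $\mathbb Q$. The orientation is weakly admissible if $\operatorname{rk}Z(p)=dn-\binom{d+1}{2}$ for every generic $p$; admissible if $Z(p)|_{\operatorname{im}R(p)}$ is invertible for every generic $p$; strongly admissible if, for every generic $p$, all eigenvalues of $Z(p)|_{\operatorname{im}R(p)}$ have non-zero real part. *)

theory Defs
  imports "HOL-Analysis.Analysis"
begin

text \<open>
  Configurations of the vertex set \<open>'n\<close> in \<open>\<real>\<^sup>d\<close> are elements of \<open>real ^ 'd ^ 'n\<close>, so that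
  \<open>d = CARD('d)\<close> and \<open>n = CARD('n)\<close>. A graph is given by its edge set \<open>E :: 'n set set\<close>, an
  orientation by its set of (tail, head) pairs. The edge set is not a type, so the edge space
  \<open>\<real>\<^sup>E\<close> is realised as the coordinate subspace of \<open>real ^ ('n set)\<close> whose coordinates outside
  \<open>E\<close> vanish: vectors and matrices indexed by edges are extended by zero. This changes neither
  images, nor ranks, nor restrictions to subspaces of \<open>\<real>\<^sup>E\<close>.
\<close>

type_synonym ('d, 'n) config = "real ^ 'd ^ 'n"

inductive rat_polynomial_function :: "(('d::finite, 'n::finite) config \<Rightarrow> real) \<Rightarrow> bool" where
  const: "rat_polynomial_function (\<lambda>p. real_of_rat c)"
| coord: "rat_polynomial_function (\<lambda>p. p $ i $ k)"
| add: "rat_polynomial_function f \<Longrightarrow> rat_polynomial_function g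
    \<Longrightarrow> rat_polynomial_function (\<lambda>p. f p + g p)"
| mult: "rat_polynomial_function f \<Longrightarrow> rat_polynomial_function g
    \<Longrightarrow> rat_polynomial_function (\<lambda>p. f p * g p)"

definition algebraic_over_rat :: "('d::finite, 'n::finite) config set \<Rightarrow> bool" where
  "algebraic_over_rat S \<longleftrightarrow>
     (\<exists>P. (\<forall>f\<in>P. rat_polynomial_function f) \<and> S = {p. \<forall>f\<in>P. f p = 0})"

definition for_generic :: "(('d::finite, 'n::finite) config \<Rightarrow> bool) \<Rightarrow> bool" where
  "for_generic Q \<longleftrightarrow> (\<exists>S. algebraic_over_rat S \<and> S \<noteq> UNIV \<and> (\<forall>p. p \<notin> S \<longrightarrow> Q p))"

definition simple_graph :: "'n set set \<Rightarrow> bool" where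
  "simple_graph E \<longleftrightarrow> (\<forall>e\<in>E. card e = 2)"

definition orientation :: "'n set set \<Rightarrow> ('n \<times> 'n) set \<Rightarrow> bool" where
  "orientation E A \<longleftrightarrow>
     (\<forall>(i, j)\<in>A. {i, j} \<in> E) \<and> (\<forall>e\<in>E. \<exists>!a. a \<in> A \<and> e = {fst a, snd a})"

definition other_end :: "'n set \<Rightarrow> 'n \<Rightarrow> 'n" where
  "other_end e i = (THE j. e = {i, j})"

definition distance_map ::
    "'n set set \<Rightarrow> ('d::finite, 'n::finite) config \<Rightarrow> real ^ ('n set)" where
  "distance_map E p =
     (\<chi> e. if e \<in> E then (THE l. \<exists>i j. e = {i, j} \<and> l = (norm (p $ j - p $ i))\<^sup>2) else 0)"

definition congruent_config ::
    "('d::finite, 'n::finite) config \<Rightarrow> ('d, 'n) config \<Rightarrow> bool" where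
  "congruent_config p q \<longleftrightarrow>
     (\<exists>T. (\<forall>x y. dist (T x) (T y) = dist x y) \<and> (\<forall>i. q $ i = T (p $ i)))"

text \<open>The type argument supplies the dimension \<open>d\<close>, which \<open>E\<close> alone does not determine.\<close>

definition generically_rigid :: "'d::finite itself \<Rightarrow> 'n::finite set set \<Rightarrow> bool" where
  "generically_rigid _ E \<longleftrightarrow>
     for_generic (\<lambda>p :: ('d, 'n) config.
       \<exists>\<epsilon>>0. \<forall>q. dist q p < \<epsilon> \<and> distance_map E q = distance_map E p \<longrightarrow> congruent_config p q)"

definition rigidity_matrix ::
    "'n set set \<Rightarrow> ('d::finite, 'n::finite) config \<Rightarrow> real ^ ('n \<times> 'd) ^ ('n set)" where
  "rigidity_matrix E p =
     (\<chi> e c. case c of (i, k) \<Rightarrow>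
       if e \<in> E \<and> i \<in> e then (p $ i - p $ other_end e i) $ k else 0)"

definition directed_rigidity_matrix ::
    "'n set set \<Rightarrow> ('n \<times> 'n) set \<Rightarrow> ('d::finite, 'n::finite) config
      \<Rightarrow> real ^ ('n \<times> 'd) ^ ('n set)" where
  "directed_rigidity_matrix E A p =
     (\<chi> e c. case c of (i, k) \<Rightarrow>
       if \<exists>j. (j, i) \<in> A \<and> e = {j, i} then 0 else rigidity_matrix E p $ e $ (i, k))"

definition edge_operator ::
    "'n set set \<Rightarrow> ('n \<times> 'n) set \<Rightarrow> ('d::finite, 'n::finite) config
      \<Rightarrow> real ^ ('n set) ^ ('n set)" where
  "edge_operator E A p =
     2 *\<^sub>R (rigidity_matrix E p ** transpose (directed_rigidity_matrix E A p))"

definition rigidity_image ::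
    "'n set set \<Rightarrow> ('d::finite, 'n::finite) config \<Rightarrow> (real ^ ('n set)) set" where
  "rigidity_image E p = range ((*v) (rigidity_matrix E p))"

text \<open>
  Complex eigenvalues of \<open>M\<close> restricted to \<open>W\<close>: the eigenvectors range over the
  complexification \<open>W + \<i> W\<close>, i.e. the complex vectors with real and imaginary part in \<open>W\<close>.
\<close>

definition complexification :: "(real ^ 'm) set \<Rightarrow> (complex ^ 'm) set" where
  "complexification W = {v. (\<chi> i. Re (v $ i)) \<in> W \<and> (\<chi> i. Im (v $ i)) \<in> W}"

definition eigenvalue_on :: "real ^ 'm ^ 'm \<Rightarrow> (real ^ 'm) set \<Rightarrow> complex \<Rightarrow> bool" where
  "eigenvalue_on M W c \<longleftrightarrow>
     (\<exists>v\<in>complexification W. v \<noteq> 0 \<and> map_matrix complex_of_real M *v v = c *s v)"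

definition hurwitz_on :: "real ^ 'm ^ 'm \<Rightarrow> (real ^ 'm) set \<Rightarrow> bool" where
  "hurwitz_on M W \<longleftrightarrow> (\<forall>c. eigenvalue_on M W c \<longrightarrow> Re c < 0)"

definition weakly_admissible ::
    "'d::finite itself \<Rightarrow> 'n::finite set set \<Rightarrow> ('n \<times> 'n) set \<Rightarrow> bool" where
  "weakly_admissible _ E A \<longleftrightarrow>
     for_generic (\<lambda>p :: ('d, 'n) config.
       int (rank (edge_operator E A p)) =
         int (CARD('d) * CARD('n)) - int ((CARD('d) + 1) choose 2))"

definition admissible ::
    "'d::finite itself \<Rightarrow> 'n::finite set set \<Rightarrow> ('n \<times> 'n) set \<Rightarrow> bool" where
  "admissible _ E A \<longleftrightarrow>
     for_generic (\<lambda>p :: ('d, 'n) config.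
       bij_betw ((*v) (edge_operator E A p)) (rigidity_image E p) (rigidity_image E p))"

definition strongly_admissible ::
    "'d::finite itself \<Rightarrow> 'n::finite set set \<Rightarrow> ('n \<times> 'n) set \<Rightarrow> bool" where
  "strongly_admissible _ E A \<longleftrightarrow>
     for_generic (\<lambda>p :: ('d, 'n) config.
       \<forall>c. eigenvalue_on (edge_operator E A p) (rigidity_image E p) c \<longrightarrow> Re c \<noteq> 0)"

end

theory Submission
  imports Defs
begin

text \<open>
  Write \<open>R\<close> for the rigidity matrix, \<open>D\<close> for the directed one, \<open>Z = 2 R D\<^sup>T\<close>, and
  \<open>r = d n - (d+1 choose 2)\<close>. For an edge vector \<open>x\<close> the vector \<open>y = D\<^sup>T x\<close> collects forces: \<open>y i\<close> is
  a combination of the vectors \<open>p i - p h\<close> over the arcs \<open>(i, h)\<close> leaving \<open>i\<close>.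

  Everything spectral comes from looking at a vertex \<open>i\<close> with \<open>y i \<noteq> 0\<close> all of whose
  out-neighbours carry no force; it exists because the orientation is acyclic. At such a vertex
  \<open>2 D\<^sup>T R\<close> acts on \<open>y i\<close> as the positive semidefinite operator
  \<open>v \<mapsto> 2 \<Sum>\<^sub>h ((p i - p h) \<bullet> v) (p i - p h)\<close>, which is definite on the span of the \<open>p i - p h\<close>, where
  \<open>y i\<close> lives. So \<open>D\<^sup>T Z x = c D\<^sup>T x\<close> with \<open>D\<^sup>T x \<noteq> 0\<close> forces \<open>c > 0\<close>, and every eigenvalue of
  \<open>Z\<close> is zero or positive (\<open>edge_operator_force_spectrum\<close>, \<open>edge_operator_eigenvalue\<close>).
  As \<open>Z\<close> maps \<open>im R\<close> to itself, admissibility, strong admissibility and the Hurwitz property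
  then coincide already for each single configuration.

  For weak admissibility ranks are compared. Ordering the vertices topologically, the vertex in
  position \<open>k\<close> has at most \<open>min d k\<close> independent force directions, whence \<open>rk D \<le> r\<close>
  (\<open>rank_directed_rigidity_matrix\<close>). If \<open>rk Z = r\<close>, then \<open>ker Z = ker D\<^sup>T\<close>, and the positivity above, in
  the form \<open>D\<^sup>T Z x = 0 \<Longrightarrow> D\<^sup>T x = 0\<close>, makes \<open>Z\<close> injective on its image. That image is \<open>im R\<close> as soon as
  \<open>rk R \<le> r\<close>, which holds generically because the infinitesimal isometries lie in \<open>ker R\<close>
  (\<open>for_generic_rank_upper\<close>). Conversely, if \<open>Z\<close> is bijective on \<open>im R\<close>, then \<open>rk Z = rk R\<close>, so
  one needs \<open>rk R = r\<close> generically. Only here rigidity enters, through \<open>for_generic_rank_lower\<close>: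
  where the rank of \<open>R\<close> is locally maximal, each element of \<open>ker R\<close> is the velocity of a curve of
  configurations with constant edge lengths (\<open>constant_rank_curve\<close>); by rigidity the curve is a
  motion by isometries, so the velocity preserves all distances to first order, and at a generic
  configuration such velocities form a space of dimension at most \<open>(d+1 choose 2)\<close>.
\<close>

section \<open>Generic properties and generic ranks\<close>

lemma rat_polynomial_sum:
  assumes "\<And>i. i \<in> I \<Longrightarrow> rat_polynomial_function (f i)"
  shows "rat_polynomial_function (\<lambda>p. \<Sum>i\<in>I. f i p)"
proof (cases "finite I")
  case True
  then show ?thesis using assms
    by (induction) (use rat_polynomial_function.const[of 0] in \<open>auto intro: rat_polynomial_function.add\<close>)
qed (use rat_polynomial_function.const[of 0] in auto)

lemma rat_polynomial_prod:
  assumes "\<And>i. i \<in> I \<Longrightarrow> rat_polynomial_function (f i)"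
  shows "rat_polynomial_function (\<lambda>p. \<Prod>i\<in>I. f i p)"
proof (cases "finite I")
  case True
  then show ?thesis using assms
    by (induction) (use rat_polynomial_function.const[of 1] in \<open>auto intro: rat_polynomial_function.mult\<close>)
qed (use rat_polynomial_function.const[of 1] in auto)

lemma rat_polynomial_of_int: "rat_polynomial_function (\<lambda>p. of_int m)"
  using rat_polynomial_function.const[of "of_int m"] by simp

lemma rat_polynomial_0: "rat_polynomial_function (\<lambda>p. 0)"
  and rat_polynomial_1: "rat_polynomial_function (\<lambda>p. 1)"
  using rat_polynomial_of_int[of 0] rat_polynomial_of_int[of 1] by simp_all

lemma rat_polynomial_diff:
  assumes "rat_polynomial_function f" "rat_polynomial_function g"
  shows "rat_polynomial_function (\<lambda>p. f p - g p)"
  using rat_polynomial_function.add[OF assms(1)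
      rat_polynomial_function.mult[OF rat_polynomial_of_int[of "-1"] assms(2)]] by simp

lemma rat_polynomial_uminus:
  assumes "rat_polynomial_function f"
  shows "rat_polynomial_function (\<lambda>p. - f p)"
  using rat_polynomial_diff[OF rat_polynomial_0 assms] by simp

lemma rat_polynomial_det:
  fixes M :: "('d::finite, 'n::finite) config \<Rightarrow> real ^ 'b ^ 'b"
  assumes "\<And>i j. rat_polynomial_function (\<lambda>p. M p $ i $ j)"
  shows "rat_polynomial_function (\<lambda>p. det (M p))"
  unfolding det_def
  by (intro rat_polynomial_sum rat_polynomial_function.mult rat_polynomial_prod
      rat_polynomial_of_int assms)

lemma rat_polynomial_continuous:
  assumes "rat_polynomial_function f"
  shows "continuous_on UNIV f"
  using assms by induction (auto intro!: continuous_intros)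

text \<open>
  Restriction to lines reduces questions on products of non-zero polynomial functions to
  univariate polynomials.
\<close>

lemma rat_polynomial_on_line:
  assumes "rat_polynomial_function f"
  shows "\<exists>P. \<forall>t. f (p + t *\<^sub>R v) = poly P t"
  using assms
proof induction
  case (const c)
  show ?case by (rule exI[of _ "[:real_of_rat c:]"]) simp
next
  case (coord i k)
  show ?case by (rule exI[of _ "[:p $ i $ k, v $ i $ k:]"]) simp
next
  case (add f g)
  then obtain P Q where "\<forall>t. f (p + t *\<^sub>R v) = poly P t" "\<forall>t. g (p + t *\<^sub>R v) = poly Q t"
    by blast
  then show ?case by (intro exI[of _ "P + Q"]) simp
next
  case (mult f g)
  then obtain P Q where "\<forall>t. f (p + t *\<^sub>R v) = poly P t" "\<forall>t. g (p + t *\<^sub>R v) = poly Q t"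
    by blast
  then show ?case by (intro exI[of _ "P * Q"]) simp
qed

lemma for_generic_iff_polynomial:
  "for_generic Q \<longleftrightarrow>
    (\<exists>f. rat_polynomial_function f \<and> (\<exists>p. f p \<noteq> 0) \<and> (\<forall>p. f p \<noteq> 0 \<longrightarrow> Q p))"
proof
  assume "for_generic Q"
  then show "\<exists>f. rat_polynomial_function f \<and> (\<exists>p. f p \<noteq> 0) \<and> (\<forall>p. f p \<noteq> 0 \<longrightarrow> Q p)"
    unfolding for_generic_def algebraic_over_rat_def by blast
next
  assume "\<exists>f. rat_polynomial_function f \<and> (\<exists>p. f p \<noteq> 0) \<and> (\<forall>p. f p \<noteq> 0 \<longrightarrow> Q p)"
  then obtain f p where f: "rat_polynomial_function f" "f p \<noteq> 0" "\<And>p. f p \<noteq> 0 \<Longrightarrow> Q p"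
    by blast
  have "algebraic_over_rat {p. f p = 0}"
    unfolding algebraic_over_rat_def by (rule exI[of _ "{f}"]) (use f in auto)
  then show "for_generic Q"
    unfolding for_generic_def using f by (intro exI[of _ "{p. f p = 0}"]) auto
qed

lemma for_generic_mono:
  assumes "for_generic P" "\<And>p. P p \<Longrightarrow> Q p"
  shows "for_generic Q"
  using assms unfolding for_generic_def by blast

text \<open>
  Two non-empty sets \<open>{f \<noteq> 0}\<close> and \<open>{g \<noteq> 0}\<close> meet: join a point of the first with a point
  of the second by a line, on which neither \<open>f\<close> nor \<open>g\<close> vanishes identically.
\<close>

lemma for_generic_conj:
  assumes "for_generic P" "for_generic Q"
  shows "for_generic (\<lambda>p. P p \<and> Q p)"
proof -
  obtain f p where f: "rat_polynomial_function f" "f p \<noteq> 0" "\<And>p. f p \<noteq> 0 \<Longrightarrow> P p"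
    using assms(1) for_generic_iff_polynomial by blast
  obtain g q where g: "rat_polynomial_function g" "g q \<noteq> 0" "\<And>p. g p \<noteq> 0 \<Longrightarrow> Q p"
    using assms(2) for_generic_iff_polynomial by blast
  obtain F where F: "\<And>t. f (p + t *\<^sub>R (q - p)) = poly F t"
    using rat_polynomial_on_line[OF f(1)] by blast
  obtain G where G: "\<And>t. g (p + t *\<^sub>R (q - p)) = poly G t"
    using rat_polynomial_on_line[OF g(1)] by blast
  have "poly F 0 \<noteq> 0" "poly G 1 \<noteq> 0"
    using f(2) g(2) F[of 0] G[of 1] by auto
  then have "F * G \<noteq> 0" by auto
  then obtain t where "poly (F * G) t \<noteq> 0"
    using poly_all_0_iff_0 by blast
  then have "f (p + t *\<^sub>R (q - p)) * g (p + t *\<^sub>R (q - p)) \<noteq> 0"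
    by (simp add: F G)
  then show ?thesis
    unfolding for_generic_iff_polynomial
    by (intro exI[of _ "\<lambda>p. f p * g p"])
      (use f g in \<open>auto intro!: rat_polynomial_function.mult\<close>)
qed

lemma card_le_rank:
  fixes N :: "real ^ 'a ^ 'b"
  assumes "\<And>x. (\<And>i. i \<notin> I \<Longrightarrow> x $ i = 0) \<Longrightarrow> transpose N *v x = 0 \<Longrightarrow> x = 0"
  shows "card I \<le> rank N"
proof -
  define X where "X = {x :: real ^ 'b. \<forall>i. i \<notin> I \<longrightarrow> x $ i = 0}"
  have sub: "subspace X" by (auto simp: X_def subspace_def)
  have "inj_on ((*v) (transpose N)) X"
  proof (rule inj_onI)
    fix x y assume "x \<in> X" "y \<in> X" "transpose N *v x = transpose N *v y"
    then have "x - y = 0"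
      by (intro assms) (auto simp: X_def matrix_vector_mult_diff_distrib)
    then show "x = y" by simp
  qed
  then have "dim ((*v) (transpose N) ` X) = dim X"
    by (intro dim_image_eq) (use sub in \<open>auto simp: span_eq_iff[THEN iffD2]\<close>)
  moreover have "dim X = card I"
    unfolding X_def using dim_substandard_cart[where 'a = real and d = I] unfolding dim_vec_eq by simp
  moreover have "dim ((*v) (transpose N) ` X) \<le> rank (transpose N)"
    unfolding rank_dim_range by (rule dim_subset) auto
  ultimately show ?thesis by (simp add: rank_transpose)
qed

lemma independent_rows_exist:
  fixes N :: "real ^ 'a ^ 'b"
  shows "\<exists>I. card I = rank N \<and>
    (\<forall>x. (\<forall>i. i \<notin> I \<longrightarrow> x $ i = 0) \<and> transpose N *v x = 0 \<longrightarrow> x = 0)"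
proof -
  obtain B where B: "B \<subseteq> rows N" "independent B" "card B = dim (rows N)"
    using basis_exists by metis
  have "rows N = (\<lambda>i. row i N) ` UNIV"
    by (auto simp: rows_def)
  then obtain I where I: "inj_on (\<lambda>i. row i N) I" "B = (\<lambda>i. row i N) ` I"
    using B(1) subset_image_inj by metis
  have "x = 0" if x: "\<forall>i. i \<notin> I \<longrightarrow> x $ i = 0" "transpose N *v x = 0" for x
  proof -
    have "0 = (\<Sum>i\<in>UNIV. x $ i *\<^sub>R row i N)"
      using x(2) by (simp add: matrix_mult_sum scalar_mult_eq_scaleR)
    also have "\<dots> = (\<Sum>i\<in>I. x $ i *\<^sub>R row i N)"
      by (intro sum.mono_neutral_right) (use x(1) in auto)
    also have "\<dots> = (\<Sum>b\<in>B. x $ inv_into I (\<lambda>i. row i N) b *\<^sub>R b)"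
      unfolding I(2) sum.reindex[OF I(1)] by (intro sum.cong refl) (simp add: inv_into_f_f[OF I(1)])
    finally have 0: "(\<Sum>b\<in>B. x $ inv_into I (\<lambda>i. row i N) b *\<^sub>R b) = 0" by (rule sym)
    have "x $ inv_into I (\<lambda>i. row i N) b = 0" if "b \<in> B" for b
      by (rule independentD[OF B(2) independent_imp_finite[OF B(2)] subset_refl 0 that])
    then have "x $ i = 0" if "i \<in> I" for i
      using that I by (metis imageI inv_into_f_f)
    then show ?thesis using x(1) by (metis vec_eq_iff zero_index)
  qed
  moreover have "card I = rank N"
    using B(3) I by (simp add: card_image row_rank_def)
  ultimately show ?thesis by blast
qed

text \<open>
  Lower semicontinuity of the rank, with a rational polynomial as witness: rows of \<open>M p\<close> chosen
  to form a basis of the row space of \<open>M p0\<close> are independent wherever their Gram determinant does not vanish.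
\<close>

lemma for_generic_rank_ge:
  fixes M :: "('d::finite, 'n::finite) config \<Rightarrow> real ^ 'a ^ 'b"
  assumes M: "\<And>i j. rat_polynomial_function (\<lambda>p. M p $ i $ j)"
  shows "for_generic (\<lambda>p. rank (M p0) \<le> rank (M p))"
proof -
  obtain I where I: "card I = rank (M p0)"
    "\<And>x. (\<forall>i. i \<notin> I \<longrightarrow> x $ i = 0) \<Longrightarrow> transpose (M p0) *v x = 0 \<Longrightarrow> x = 0"
    using independent_rows_exist[of "M p0"] by blast
  define X where "X = {x :: real ^ 'b. \<forall>i. i \<notin> I \<longrightarrow> x $ i = 0}"
  \<comment> \<open>the Gram matrix of the rows in \<open>I\<close>, completed by an identity block to a matrix indexed by a type\<close>
  define G :: "('d, 'n) config \<Rightarrow> real ^ 'b ^ 'b" where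
    "G p = (\<chi> i j. if i \<in> I \<and> j \<in> I then (\<Sum>k\<in>UNIV. M p $ i $ k * M p $ j $ k)
                   else if i = j then 1 else 0)" for p
  have Gx: "(G p *v x) $ i = (if i \<in> I then (M p *v (transpose (M p) *v x)) $ i else x $ i)"
    if "x \<in> X \<or> i \<notin> I" for p x i
  proof (cases "i \<in> I")
    case True
    then have x: "x $ j = 0" if "j \<notin> I" for j using \<open>x \<in> X \<or> i \<notin> I\<close> that by (auto simp: X_def)
    have "(G p *v x) $ i = (\<Sum>j\<in>UNIV. (\<Sum>k\<in>UNIV. M p $ i $ k * M p $ j $ k) * x $ j)"
      unfolding matrix_vector_mult_def G_def using True x by (auto intro!: sum.cong)
    also have "\<dots> = (M p *v (transpose (M p) *v x)) $ i"
      unfolding matrix_vector_mul_assoc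
      by (simp add: matrix_vector_mult_def matrix_matrix_mult_def transpose_def)
    finally show ?thesis using True by simp
  next
    case False
    then have "(G p *v x) $ i = (\<Sum>j\<in>UNIV. if i = j then x $ j else 0)"
      unfolding matrix_vector_mult_def G_def vec_lambda_beta by (intro sum.cong refl) simp
    then show ?thesis using False by simp
  qed
  have det: "det (G p) \<noteq> 0 \<longleftrightarrow> (\<forall>x\<in>X. transpose (M p) *v x = 0 \<longrightarrow> x = 0)" for p
  proof -
    have "det (G p) \<noteq> 0 \<longleftrightarrow> (\<forall>x. G p *v x = 0 \<longrightarrow> x = 0)"
      by (metis invertible_det_nz invertible_left_inverse matrix_left_invertible_ker)
    also have "\<dots> \<longleftrightarrow> (\<forall>x\<in>X. transpose (M p) *v x = 0 \<longrightarrow> x = 0)"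
    proof -
      have "G p *v x = 0 \<longleftrightarrow> x \<in> X \<and> transpose (M p) *v x = 0" for x
      proof
        assume 0: "G p *v x = 0"
        have "x $ i = 0" if "i \<notin> I" for i
          using Gx[of x i p] 0 that by simp
        then have "x \<in> X" by (simp add: X_def)
        have "(transpose (M p) *v x) \<bullet> (transpose (M p) *v x) = x \<bullet> (M p *v (transpose (M p) *v x))"
          by (simp only: transpose_matrix_vector dot_lmul_matrix)
        also have "\<dots> = 0"
          unfolding inner_vec_def
        proof (intro sum.neutral ballI)
          fix i show "x $ i \<bullet> (M p *v (transpose (M p) *v x)) $ i = 0"
            using Gx[of x i p] 0 \<open>x \<in> X\<close> by (cases "i \<in> I") (auto simp: X_def)
        qed
        finally show "x \<in> X \<and> transpose (M p) *v x = 0" using \<open>x \<in> X\<close> by simp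
      next
        assume "x \<in> X \<and> transpose (M p) *v x = 0"
        then have "(G p *v x) $ i = 0" for i
          using Gx[of x i p] by (cases "i \<in> I") (auto simp: X_def simp del: transpose_matrix_vector)
        then show "G p *v x = 0" by (simp add: vec_eq_iff)
      qed
      then show ?thesis by blast
    qed
    finally show ?thesis .
  qed
  have "rank (M p0) \<le> rank (M p)" if "det (G p) \<noteq> 0" for p
    unfolding I(1)[symmetric]
    by (rule card_le_rank) (use det[of p] that in \<open>auto simp: X_def simp del: transpose_matrix_vector\<close>)
  moreover have "det (G p0) \<noteq> 0"
    unfolding det using I(2) by (auto simp: X_def)
  moreover have "rat_polynomial_function (\<lambda>p. det (G p))"
  proof (rule rat_polynomial_det)
    show "rat_polynomial_function (\<lambda>p. G p $ i $ j)" for i j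
      by (cases "i \<in> I \<and> j \<in> I"; cases "i = j")
        (auto simp: G_def intro!: rat_polynomial_sum rat_polynomial_function.mult M
          rat_polynomial_0 rat_polynomial_1)
  qed
  ultimately show ?thesis
    unfolding for_generic_iff_polynomial by blast
qed

lemma rank_nullity:
  fixes M :: "real ^ 'a ^ 'b"
  shows "dim {x. M *v x = 0} + rank M = CARD('a)"
proof -
  have "{x. M *v x = 0} = {y. \<forall>x\<in>span (rows M). orthogonal x y}"
  proof safe
    fix x r assume "M *v x = 0" "r \<in> span (rows M)"
    then show "orthogonal r x"
      by (meson orthogonal_commute orthogonal_nullspace_rowspace)
  next
    fix y assume "\<forall>x\<in>span (rows M). orthogonal x y"
    then have "row i M \<bullet> y = 0" for i
      by (auto simp: orthogonal_def rows_def intro: span_base)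
    then show "M *v y = 0"
      by (simp add: vec_eq_iff matrix_vector_mul_component row_def)
  qed
  then show ?thesis
    using dim_subspace_orthogonal_to_vectors[of "span (rows M)" UNIV]
    by (simp add: row_rank_def)
qed

section \<open>Curves in the fibres of a map of constant rank\<close>

text \<open>
  Let \<open>N\<close> be the kernel of the derivative at \<open>p\<close>. The map \<open>\<Phi> q = P (q - p) + T (F q)\<close>, with
  \<open>P\<close> a map onto \<open>N\<close> and \<open>T\<close> the adjoint of the derivative at \<open>p\<close>, is a local diffeomorphism, and the
  curve sought is the \<open>\<Phi>\<close>-preimage of a segment in direction \<open>P w \<in> N\<close>. At any nearby \<open>q\<close> the derivative
  \<open>D q\<close> of \<open>\<Phi>\<close> is injective and maps \<open>ker (F' q)\<close> into \<open>N\<close>; as this kernel is at least as large as \<open>N\<close>,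
  it is mapped onto \<open>N\<close>. Hence the velocity of the curve always lies in \<open>ker (F' q)\<close>, and \<open>F\<close> is
  constant along the curve.
\<close>

lemma constant_rank_curve:
  fixes F :: "'a::euclidean_space \<Rightarrow> 'b::euclidean_space"
  assumes U: "open U" "p \<in> U"
    and derF: "\<And>q. q \<in> U \<Longrightarrow> (F has_derivative F' q) (at q)"
    and contF: "\<And>v. continuous_on U (\<lambda>q. F' q v)"
    and dims: "\<And>q. q \<in> U \<Longrightarrow> dim {v. F' p v = 0} \<le> dim {v. F' q v = 0}"
    and w: "F' p w = 0"
  obtains \<gamma> \<epsilon> where "\<epsilon> > 0" "\<gamma> 0 = p" "(\<gamma> has_vector_derivative w) (at 0)"
    "\<And>t :: real. \<bar>t\<bar> < \<epsilon> \<Longrightarrow> F (\<gamma> t) = F p"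
proof -
  define N where "N = {v. F' p v = 0}"
  have lin: "linear (F' q)" if "q \<in> U" for q
    using derF[OF that] has_derivative_linear by blast
  have linp: "linear (F' p)" using lin U(2) by blast
  have subK: "subspace {v. F' q v = 0}" if "q \<in> U" for q
    by (rule linear_subspace_kernel) (rule lin[OF that])
  obtain B where B: "B \<subseteq> N" "independent B" "N \<subseteq> span B"
    using basis_exists by metis
  have finB: "finite B" using B(2) independent_imp_finite by blast
  define P where "P v = (\<Sum>b\<in>B. (v \<bullet> b) *\<^sub>R b)" for v
  have linP: "linear P"
    unfolding P_def by (rule linearI) (auto simp: inner_add_left scaleR_add_left sum.distrib scaleR_sum_right)
  have PN: "P v \<in> N" for v
    unfolding P_def N_def
    by (rule subspace_sum[OF subK[OF U(2)]]) (use B(1) in \<open>auto simp: N_def linear_cmul[OF linp]\<close>)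
  have P0: "v = 0" if "P v = 0" "v \<in> N" for v
  proof -
    have "(\<Sum>b\<in>B. (v \<bullet> b)\<^sup>2) = v \<bullet> P v"
      by (simp add: P_def inner_sum_right power2_eq_square)
    then have "\<forall>b\<in>B. v \<bullet> b = 0"
      using that(1) finB by (simp add: sum_nonneg_eq_0_iff)
    then have "orthogonal v v"
      using that(2) B(3) orthogonal_to_span[of v B v] by (auto simp: orthogonal_def)
    then show ?thesis by (simp add: orthogonal_def)
  qed
  define T where "T = adjoint (F' p)"
  have linT: "linear T" unfolding T_def using linp by (rule adjoint_linear)
  have T: "T y \<bullet> z = y \<bullet> F' p z" for y z
    unfolding T_def using adjoint_works[OF linp] by (simp add: inner_commute)
  define \<Phi> where "\<Phi> q = P (q - p) + T (F q)" for q
  define D where "D q v = P v + T (F' q v)" for q v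
  have linD: "linear (D q)" if "q \<in> U" for q
    unfolding D_def using linear_compose[OF lin[OF that] linT] linP
    by (auto simp: o_def intro: linear_compose_add)
  have der\<Phi>: "(\<Phi> has_derivative D q) (at q)" if "q \<in> U" for q
  proof -
    have "((\<lambda>q. P (q - p)) has_derivative (\<lambda>v. P (v - 0))) (at q)"
      by (intro bounded_linear.has_derivative[OF linear_conv_bounded_linear[THEN iffD1, OF linP]]
          derivative_intros)
    moreover have "((\<lambda>q. T (F q)) has_derivative (\<lambda>v. T (F' q v))) (at q)"
      by (intro bounded_linear.has_derivative[OF linear_conv_bounded_linear[THEN iffD1, OF linT]]
          derF that)
    ultimately show ?thesis
      unfolding \<Phi>_def[abs_def] D_def[abs_def] using has_derivative_add by fastforce
  qed
  have injD: "inj (D p)"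
    unfolding linear_injective_0[OF linD[OF U(2)]]
  proof (intro allI impI)
    fix v assume 0: "D p v = 0"
    have "T (F' p v) \<bullet> P v = 0"
      using PN[of v] by (simp add: T N_def)
    then have "P v \<bullet> P v = 0"
      using 0 by (metis D_def add.right_neutral inner_add_left inner_zero_left)
    then have "P v = 0" by simp
    then have "T (F' p v) \<bullet> v = 0" using 0 by (simp add: D_def)
    then have "v \<in> N" by (simp add: T N_def)
    then show "v = 0" using P0 \<open>P v = 0\<close> by blast
  qed
  define f' where "f' q = Blinfun (D q)" for q
  have f': "blinfun_apply (f' q) = D q" if "q \<in> U" for q
    unfolding f'_def using linD[OF that] by (simp add: bounded_linear_Blinfun_apply linear_conv_bounded_linear)
  obtain G where G: "linear G" "G \<circ> D p = id"
    using linear_injective_left_inverse[OF linD[OF U(2)] injD] by blast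
  have inv: "Blinfun G o\<^sub>L f' p = id_blinfun"
    using G by (intro blinfun_eqI)
      (simp add: f' U(2) bounded_linear_Blinfun_apply linear_conv_bounded_linear o_def fun_eq_iff)
  have contf': "continuous_on U f'"
  proof (rule continuous_on_blinfun_componentwise)
    fix v :: 'a
    have "continuous_on U (\<lambda>q. D q v)"
      unfolding D_def
      by (intro continuous_intros linear_continuous_on_compose[OF contF linT])
    then show "continuous_on U (\<lambda>q. blinfun_apply (f' q) v)"
      by (rule continuous_on_eq) (simp add: f')
  qed
  obtain U' V g g' where g: "open U'" "U' \<subseteq> U" "p \<in> U'" "open V" "\<Phi> p \<in> V"
    "homeomorphism U' V \<Phi> g"
    "\<And>y. y \<in> V \<Longrightarrow> (g has_derivative (g' y)) (at y)"
    "\<And>y. y \<in> V \<Longrightarrow> g' y = inv (blinfun_apply (f' (g y)))"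
    "\<And>y. y \<in> V \<Longrightarrow> bij (blinfun_apply (f' (g y)))"
    by (rule inverse_function_theorem[OF U(1) _ contf' U(2) inv, of \<Phi>]) (use der\<Phi> f' in auto)
  have gU: "g y \<in> U" if "y \<in> V" for y
    using g(2,6) that unfolding homeomorphism_def by blast
  define w' where "w' = D p w"
  have w'N: "w' \<in> N"
    using PN[of w] w by (simp add: w'_def D_def linear_0[OF linT])
  define \<gamma> where "\<gamma> t = g (\<Phi> p + t *\<^sub>R w')" for t
  have "open ((\<lambda>t. \<Phi> p + t *\<^sub>R w') -` V)"
    by (intro open_vimage g(4) continuous_intros)
  moreover have "0 \<in> (\<lambda>t. \<Phi> p + t *\<^sub>R w') -` V"
    using g(5) by simp
  ultimately obtain \<epsilon> where \<epsilon>: "\<epsilon> > 0" "ball 0 \<epsilon> \<subseteq> (\<lambda>t. \<Phi> p + t *\<^sub>R w') -` V"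
    using open_contains_ball by blast
  have V: "\<Phi> p + t *\<^sub>R w' \<in> V" if "\<bar>t\<bar> < \<epsilon>" for t
    using \<epsilon>(2) that by (auto simp: ball_def)
  have der\<gamma>: "(\<gamma> has_derivative (\<lambda>s. s *\<^sub>R k)) (at t)"
    if "\<bar>t\<bar> < \<epsilon>" "D (\<gamma> t) k = w'" for t k
  proof -
    let ?y = "\<Phi> p + t *\<^sub>R w'"
    have bij: "bij (D (\<gamma> t))" and g': "g' ?y = inv (D (\<gamma> t))"
      using g(8,9)[OF V[OF that(1)]] f'[OF gU[OF V[OF that(1)]]] by (simp_all add: \<gamma>_def)
    have "inv (D (\<gamma> t)) w' = k"
      using bij that(2) by (metis bij_inv_eq_iff)
    moreover have "linear (g' ?y)"
      using g(7)[OF V[OF that(1)]] has_derivative_linear by blast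
    ultimately have "g' ?y (s *\<^sub>R w') = s *\<^sub>R k" for s
      by (simp add: g' linear_cmul)
    moreover have "((\<lambda>t. g (\<Phi> p + t *\<^sub>R w')) has_derivative (\<lambda>s. g' ?y (s *\<^sub>R w'))) (at t)"
      by (rule has_derivative_compose[where f = "\<lambda>t. \<Phi> p + t *\<^sub>R w'" and g = g, OF _ g(7)[OF V[OF that(1)]]])
        (auto intro!: derivative_eq_intros)
    ultimately show ?thesis by (simp add: \<gamma>_def[abs_def])
  qed
  have "((\<lambda>t. F (\<gamma> t)) has_derivative (\<lambda>h. 0)) (at t)" if t: "\<bar>t\<bar> < \<epsilon>" for t
  proof -
    let ?K = "{v. F' (\<gamma> t) v = 0}"
    have q: "\<gamma> t \<in> U" unfolding \<gamma>_def by (intro gU V t)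
    have bij: "bij (D (\<gamma> t))"
      using g(9)[OF V[OF t]] f'[OF q] by (simp add: \<gamma>_def)
    have "dim (D (\<gamma> t) ` ?K) = dim ?K"
      by (rule dim_image_eq[OF linD[OF q]]) (use bij in \<open>auto simp: bij_def intro: inj_on_subset\<close>)
    moreover have "D (\<gamma> t) ` ?K \<subseteq> N"
      using PN by (auto simp: D_def linear_0[OF linT])
    ultimately have "D (\<gamma> t) ` ?K = N"
      using dims[OF q] subK[OF q] subK[OF U(2)] linD[OF q]
      by (intro subspace_dim_equal) (auto simp: N_def linear_subspace_image)
    then obtain k where k: "F' (\<gamma> t) k = 0" "D (\<gamma> t) k = w'"
      using w'N by blast
    have "((\<lambda>t. F (\<gamma> t)) has_derivative (\<lambda>s. F' (\<gamma> t) (s *\<^sub>R k))) (at t)"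
      by (rule has_derivative_compose[where f = \<gamma> and g = F, OF der\<gamma>[OF t k(2)] derF[OF q]])
    then show ?thesis using k(1) by (simp add: linear_cmul[OF lin[OF q]])
  qed
  then have "\<exists>c. \<forall>t\<in>ball 0 \<epsilon>. F (\<gamma> t) = c"
    by (intro has_derivative_zero_constant) (auto intro: has_derivative_at_withinI)
  then have const: "F (\<gamma> t) = F (\<gamma> 0)" if "\<bar>t\<bar> < \<epsilon>" for t
    using that \<epsilon>(1) by (auto simp: ball_def)
  have \<gamma>0: "\<gamma> 0 = p"
    using g(3,6) by (simp add: \<gamma>_def homeomorphism_apply1)
  have "(\<gamma> has_vector_derivative w) (at 0)"
    unfolding has_vector_derivative_def using der\<gamma>[of 0 w] \<epsilon>(1) by (simp add: \<gamma>0 w'_def)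
  then show ?thesis
    using that[where \<gamma> = \<gamma> and \<epsilon> = \<epsilon>] \<epsilon>(1) const \<gamma>0 by simp
qed

section \<open>The rigidity matrix\<close>

definition flatten :: "('d::finite, 'n::finite) config \<Rightarrow> real ^ ('n \<times> 'd)" where
  "flatten w = (\<chi> c. w $ fst c $ snd c)"

definition block :: "real ^ ('n \<times> 'd) \<Rightarrow> ('d::finite, 'n::finite) config" where
  "block y = (\<chi> i k. y $ (i, k))"

lemma flatten_block: "flatten (block y) = y"
  and block_flatten: "block (flatten w) = w"
  by (simp_all add: flatten_def block_def vec_eq_iff)

lemma linear_flatten: "linear flatten" and linear_block: "linear block"
  by (auto intro!: linearI simp: flatten_def block_def vec_eq_iff)

lemma inner_flatten: "y \<bullet> flatten w = (\<Sum>i\<in>UNIV. block y $ i \<bullet> w $ i)"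
proof -
  have "y \<bullet> flatten w = (\<Sum>c\<in>UNIV \<times> UNIV. case c of (i, k) \<Rightarrow> y $ (i, k) * w $ i $ k)"
    by (simp add: inner_vec_def flatten_def split_def)
  then show ?thesis
    unfolding sum.cartesian_product[symmetric] by (simp add: inner_vec_def block_def)
qed

lemma other_end_eq: "i \<noteq> j \<Longrightarrow> other_end {i, j} i = j"
  unfolding other_end_def by (rule the_equality) (auto simp: doubleton_eq_iff)

lemma simple_graph_edge:
  assumes "simple_graph E" "e \<in> E"
  obtains i j where "e = {i, j}" "i \<noteq> j"
  using assms unfolding simple_graph_def card_2_iff by blast

lemma rigidity_matrix_row:
  assumes "{i, j} \<in> E" "i \<noteq> j"
  shows "block (row {i, j} (rigidity_matrix E p)) $ l =
    (if l = i then p $ i - p $ j else if l = j then p $ j - p $ i else 0)"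
  using assms other_end_eq[of i j] other_end_eq[of j i]
  by (auto simp: vec_eq_iff block_def row_def rigidity_matrix_def insert_commute)

lemma rigidity_matrix_apply:
  assumes "{i, j} \<in> E" "i \<noteq> j"
  shows "(rigidity_matrix E p *v flatten w) $ {i, j} = (p $ i - p $ j) \<bullet> (w $ i - w $ j)"
proof -
  have "(rigidity_matrix E p *v flatten w) $ {i, j} = row {i, j} (rigidity_matrix E p) \<bullet> flatten w"
    by (simp add: matrix_vector_mul_component row_def)
  also have "\<dots> = (\<Sum>l\<in>UNIV. (if l = i then p $ i - p $ j else if l = j then p $ j - p $ i else 0) \<bullet> w $ l)"
    unfolding inner_flatten rigidity_matrix_row[OF assms] ..
  also have "\<dots> = (\<Sum>l\<in>{i, j}. (if l = i then p $ i - p $ j else if l = j then p $ j - p $ i else 0) \<bullet> w $ l)"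
    by (rule sum.mono_neutral_right) auto
  also have "\<dots> = (p $ i - p $ j) \<bullet> (w $ i - w $ j)"
    using assms(2) by (simp add: algebra_simps inner_diff_left inner_diff_right)
  finally show ?thesis .
qed

lemma rigidity_matrix_apply_nonedge:
  "e \<notin> E \<Longrightarrow> (rigidity_matrix E p *v y) $ e = 0"
  by (simp add: matrix_vector_mult_def rigidity_matrix_def split_def)

definition flexes :: "'n set set \<Rightarrow> ('d::finite, 'n::finite) config \<Rightarrow> ('d, 'n) config set" where
  "flexes E p = {w. rigidity_matrix E p *v flatten w = 0}"

lemma flexes_iff:
  assumes "simple_graph E"
  shows "w \<in> flexes E p \<longleftrightarrow> (\<forall>i j. {i, j} \<in> E \<longrightarrow> (p $ i - p $ j) \<bullet> (w $ i - w $ j) = 0)"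
proof
  assume w: "w \<in> flexes E p"
  show "\<forall>i j. {i, j} \<in> E \<longrightarrow> (p $ i - p $ j) \<bullet> (w $ i - w $ j) = 0"
  proof (intro allI impI)
    fix i j assume "{i, j} \<in> E"
    then show "(p $ i - p $ j) \<bullet> (w $ i - w $ j) = 0"
      using rigidity_matrix_apply[of i j E p w] w by (cases "i = j") (auto simp: flexes_def)
  qed
next
  assume *: "\<forall>i j. {i, j} \<in> E \<longrightarrow> (p $ i - p $ j) \<bullet> (w $ i - w $ j) = 0"
  have "(rigidity_matrix E p *v flatten w) $ e = 0" for e
  proof (cases "e \<in> E")
    case True
    then obtain i j where "e = {i, j}" "i \<noteq> j" using assms simple_graph_edge by blast
    then show ?thesis using * True rigidity_matrix_apply[of i j E p w] by simp
  qed (rule rigidity_matrix_apply_nonedge)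
  then show "w \<in> flexes E p" by (simp add: flexes_def vec_eq_iff)
qed

lemma dim_flexes:
  fixes p :: "('d::finite, 'n::finite) config"
  shows "dim (flexes E p) + rank (rigidity_matrix E p) = CARD('d) * CARD('n)"
proof -
  have "flatten ` flexes E p = {y. rigidity_matrix E p *v y = 0}"
    unfolding flexes_def by (auto simp: image_iff) (metis flatten_block)
  moreover have "dim (flatten ` flexes E p) = dim (flexes E p)"
    by (rule dim_image_eq[OF linear_flatten]) (metis block_flatten inj_on_inverseI)
  ultimately show ?thesis
    using rank_nullity[of "rigidity_matrix E p"] by (simp add: mult.commute)
qed

lemma distance_map_edge:
  assumes "{i, j} \<in> E"
  shows "distance_map E p $ {i, j} = (norm (p $ j - p $ i))\<^sup>2"
proof -
  have "(THE l. \<exists>i' j'. {i, j} = {i', j'} \<and> l = (norm (p $ j' - p $ i'))\<^sup>2) = (norm (p $ j - p $ i))\<^sup>2"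
    by (rule the_equality) (auto simp: doubleton_eq_iff norm_minus_commute)
  then show ?thesis using assms by (simp add: distance_map_def)
qed

lemma has_derivative_distance_map:
  fixes p :: "('d::finite, 'n::finite) config"
  assumes "simple_graph E"
  shows "(distance_map E has_derivative (\<lambda>w. 2 *\<^sub>R (rigidity_matrix E p *v flatten w))) (at p)"
  unfolding has_derivative_componentwise_within[of "distance_map E"]
proof
  fix b :: "real ^ ('n set)" assume "b \<in> Basis"
  then obtain e where b: "b = axis e 1" by (auto simp: Basis_vec_def)
  show "((\<lambda>p. distance_map E p \<bullet> b) has_derivative
      (\<lambda>w. (2 *\<^sub>R (rigidity_matrix E p *v flatten w)) \<bullet> b)) (at p)"
  proof (cases "e \<in> E")
    case True
    then obtain i j where e: "e = {i, j}" "i \<noteq> j" using assms simple_graph_edge by blast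
    have "(\<lambda>p :: ('d, 'n) config. distance_map E p \<bullet> b) = (\<lambda>p. (p $ j - p $ i) \<bullet> (p $ j - p $ i))"
      using True by (simp add: b inner_axis e distance_map_edge power2_norm_eq_inner)
    moreover have "(\<lambda>w. (2 *\<^sub>R (rigidity_matrix E p *v flatten w)) \<bullet> b) =
        (\<lambda>w. 2 * ((p $ i - p $ j) \<bullet> (w $ i - w $ j)))"
      using True by (simp add: b inner_axis e rigidity_matrix_apply)
    moreover have "((\<lambda>p. (p $ j - p $ i) \<bullet> (p $ j - p $ i)) has_derivative
        (\<lambda>w. 2 * ((p $ i - p $ j) \<bullet> (w $ i - w $ j)))) (at p)"
      by (auto intro!: derivative_eq_intros bounded_linear.has_derivative[OF bounded_linear_vec_nth]
          simp: fun_eq_iff inner_diff_left inner_diff_right inner_commute algebra_simps)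
    ultimately show ?thesis by (simp only:)
  next
    case False
    then show ?thesis
      by (simp add: b inner_axis distance_map_def rigidity_matrix_apply_nonedge)
  qed
qed

lemma continuous_rigidity_matrix_apply:
  fixes U :: "('d::finite, 'n::finite) config set"
  assumes "simple_graph E"
  shows "continuous_on U (\<lambda>p. rigidity_matrix E p *v flatten w)"
  unfolding continuous_on_componentwise[of U "\<lambda>p. rigidity_matrix E p *v flatten w"]
proof
  fix b :: "real ^ ('n set)" assume "b \<in> Basis"
  then obtain e where b: "b = axis e 1" by (auto simp: Basis_vec_def)
  show "continuous_on U (\<lambda>p. (rigidity_matrix E p *v flatten w) \<bullet> b)"
  proof (cases "e \<in> E")
    case True
    then obtain i j where e: "e = {i, j}" "i \<noteq> j" using assms simple_graph_edge by blast
    then show ?thesis using True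
      by (auto simp: b inner_axis rigidity_matrix_apply intro!: continuous_intros)
  next
    case False
    then show ?thesis by (simp add: b inner_axis rigidity_matrix_apply_nonedge)
  qed
qed

text \<open>
  A flex at a point of maximal rank integrates to a curve with constant edge lengths. If the
  framework is locally rigid, all pairwise distances are constant along this curve, so its
  initial velocity is a flex of the complete graph.
\<close>

lemma rigid_imp_flexes_complete:
  fixes p :: "('d::finite, 'n::finite) config"
  assumes E: "simple_graph E" and U: "open U" "p \<in> U"
    and dims: "\<And>q. q \<in> U \<Longrightarrow> dim (flexes E p) \<le> dim (flexes E q)"
    and rigid: "\<delta> > 0" "\<And>q. dist q p < \<delta> \<Longrightarrow> distance_map E q = distance_map E p \<Longrightarrow> congruent_config p q"
  shows "flexes E p \<subseteq> flexes {e. card e = 2} p"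
proof
  fix w assume w: "w \<in> flexes E p"
  have K: "simple_graph {e :: 'n set. card e = 2}" by (simp add: simple_graph_def)
  have ker: "{v. 2 *\<^sub>R (rigidity_matrix E q *v flatten v) = 0} = flexes E q" for q :: "('d, 'n) config"
    by (simp add: flexes_def)
  obtain \<gamma> \<epsilon> where \<gamma>: "\<epsilon> > 0" "\<gamma> 0 = p" "(\<gamma> has_vector_derivative w) (at 0)"
    "\<And>t. \<bar>t\<bar> < \<epsilon> \<Longrightarrow> distance_map E (\<gamma> t) = distance_map E p"
  proof (rule constant_rank_curve[OF U has_derivative_distance_map[OF E]])
    show "continuous_on U (\<lambda>q. 2 *\<^sub>R (rigidity_matrix E q *v flatten v))" for v
      by (intro continuous_intros continuous_rigidity_matrix_apply E)
    show "2 *\<^sub>R (rigidity_matrix E p *v flatten w) = 0"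
      using w by (simp add: flexes_def)
  qed (use dims in \<open>auto simp only: ker\<close>)
  have "continuous (at 0) \<gamma>"
    using \<gamma>(3) has_vector_derivative_continuous by blast
  then obtain \<eta> where \<eta>: "\<eta> > 0" "\<And>t. dist t 0 < \<eta> \<Longrightarrow> dist (\<gamma> t) p < \<delta>"
    using rigid(1) \<gamma>(2) unfolding continuous_within_eps_delta by fastforce
  show "w \<in> flexes {e. card e = 2} p"
    unfolding flexes_iff[OF K]
  proof (intro allI impI)
    fix i j :: 'n
    let ?f = "\<lambda>t. (\<gamma> t $ i - \<gamma> t $ j) \<bullet> (\<gamma> t $ i - \<gamma> t $ j)"
    have "?f t = (p $ i - p $ j) \<bullet> (p $ i - p $ j)" if "\<bar>t\<bar> < min \<epsilon> \<eta>" for t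
    proof -
      have "congruent_config p (\<gamma> t)"
        using that by (intro rigid(2) \<eta> \<gamma>) auto
      then have "dist (\<gamma> t $ i) (\<gamma> t $ j) = dist (p $ i) (p $ j)"
        unfolding congruent_config_def by metis
      then show ?thesis by (simp add: dist_norm power2_norm_eq_inner[symmetric])
    qed
    then have d0: "(?f has_derivative (\<lambda>t. 0)) (at 0)"
      using \<open>\<epsilon> > 0\<close> \<open>\<eta> > 0\<close>
      by (intro has_derivative_transform_within_open[OF has_derivative_const, of "ball 0 (min \<epsilon> \<eta>)"])
        (auto simp: dist_real_def)
    have d1: "(?f has_derivative (\<lambda>t. t * ((p $ i - p $ j) \<bullet> (w $ i - w $ j)) + t * ((p $ i - p $ j) \<bullet> (w $ i - w $ j)))) (at 0)"
    proof -
      have "((\<lambda>t. \<gamma> t $ l) has_derivative (\<lambda>t. (t *\<^sub>R w) $ l)) (at 0)" for l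
        using \<gamma>(3) unfolding has_vector_derivative_def
        by (rule bounded_linear.has_derivative[OF bounded_linear_vec_nth])
      from has_derivative_diff[OF this[of i] this[of j]]
      have "((\<lambda>t. \<gamma> t $ i - \<gamma> t $ j) has_derivative (\<lambda>t. t *\<^sub>R (w $ i - w $ j))) (at 0)"
        by (simp add: scaleR_diff_right)
      from has_derivative_inner[OF this this] show ?thesis
        by (simp add: \<gamma>(2) inner_commute)
    qed
    from fun_cong[OF has_derivative_unique[OF d1 d0], of 1]
    show "(p $ i - p $ j) \<bullet> (w $ i - w $ j) = 0" by simp
  qed
qed

section \<open>Spectrum of the edge operator of an acyclic orientation\<close>

lemma orientation_arc:
  assumes "simple_graph E" "orientation E A" "(i, j) \<in> A"
  shows "{i, j} \<in> E" "i \<noteq> j" "(j, i) \<notin> A"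
proof -
  show E: "{i, j} \<in> E" using assms(2,3) by (auto simp: orientation_def)
  then have "card {i, j} = 2" using assms(1) by (simp add: simple_graph_def)
  then show "i \<noteq> j" by auto
  have "\<exists>!a. a \<in> A \<and> {i, j} = {fst a, snd a}"
    using assms(2) E by (auto simp: orientation_def)
  then have "(j, i) \<in> A \<Longrightarrow> (i, j) = (j, i)"
    using assms(3) by (metis fst_conv snd_conv insert_commute)
  then show "(j, i) \<notin> A" using \<open>i \<noteq> j\<close> by auto
qed

lemma directed_rigidity_matrix_entry:
  assumes "simple_graph E" "orientation E A"
  shows "directed_rigidity_matrix E A p $ e $ (i, k) =
    (if \<exists>h. (i, h) \<in> A \<and> e = {i, h} then (p $ i - p $ other_end e i) $ k else 0)"
proof (cases "\<exists>h. (i, h) \<in> A \<and> e = {i, h}")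
  case True
  then obtain h where h: "(i, h) \<in> A" "e = {i, h}" by blast
  have "\<not> (\<exists>j. (j, i) \<in> A \<and> e = {j, i})"
    using orientation_arc[OF assms h(1)] h(2) by (auto simp: doubleton_eq_iff)
  then show ?thesis
    using True orientation_arc[OF assms h(1)] h(2)
    by (auto simp: directed_rigidity_matrix_def rigidity_matrix_def)
next
  case False
  have "directed_rigidity_matrix E A p $ e $ (i, k) = 0"
  proof (rule ccontr)
    assume "directed_rigidity_matrix E A p $ e $ (i, k) \<noteq> 0"
    then have e: "e \<in> E" "i \<in> e" "\<not> (\<exists>j. (j, i) \<in> A \<and> e = {j, i})"
      by (auto simp: directed_rigidity_matrix_def rigidity_matrix_def split: if_splits)
    then obtain s t where "(s, t) \<in> A" "e = {s, t}"
      using assms(2) unfolding orientation_def by (metis prod.collapse)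
    then show False using e False by auto
  qed
  then show ?thesis using False by auto
qed

lemma directed_force:
  assumes "simple_graph E" "orientation E A"
  shows "block (transpose (directed_rigidity_matrix E A p) *v x) $ i =
    (\<Sum>h | (i, h) \<in> A. x $ {i, h} *\<^sub>R (p $ i - p $ h))"
proof -
  have inj: "inj_on (\<lambda>h. {i, h}) {h. (i, h) \<in> A}"
    by (auto simp: inj_on_def doubleton_eq_iff)
  have "block (transpose (directed_rigidity_matrix E A p) *v x) $ i $ k =
    (\<Sum>h | (i, h) \<in> A. x $ {i, h} *\<^sub>R (p $ i - p $ h)) $ k" for k
  proof -
    have "block (transpose (directed_rigidity_matrix E A p) *v x) $ i $ k =
      (\<Sum>e\<in>UNIV. directed_rigidity_matrix E A p $ e $ (i, k) * x $ e)"
      by (simp add: block_def matrix_vector_mult_def transpose_def del: transpose_matrix_vector)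
    also have "\<dots> = (\<Sum>e\<in>(\<lambda>h. {i, h}) ` {h. (i, h) \<in> A}. directed_rigidity_matrix E A p $ e $ (i, k) * x $ e)"
      by (rule sum.mono_neutral_right) (auto simp: directed_rigidity_matrix_entry[OF assms])
    also have "\<dots> = (\<Sum>h | (i, h) \<in> A. directed_rigidity_matrix E A p $ {i, h} $ (i, k) * x $ {i, h})"
      by (simp add: sum.reindex[OF inj])
    also have "\<dots> = (\<Sum>h | (i, h) \<in> A. x $ {i, h} * (p $ i - p $ h) $ k)"
    proof (rule sum.cong)
      fix h assume "h \<in> {h. (i, h) \<in> A}"
      then have "(i, h) \<in> A" "i \<noteq> h" using orientation_arc[OF assms, of i h] by auto
      then show "directed_rigidity_matrix E A p $ {i, h} $ (i, k) * x $ {i, h} = x $ {i, h} * (p $ i - p $ h) $ k"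
        by (auto simp: directed_rigidity_matrix_entry[OF assms] other_end_eq)
    qed simp
    finally show ?thesis by simp
  qed
  then show ?thesis by (simp add: vec_eq_iff)
qed

lemma edge_operator_apply:
  "edge_operator E A p *v x =
    2 *\<^sub>R (rigidity_matrix E p *v (transpose (directed_rigidity_matrix E A p) *v x))"
  unfolding edge_operator_def scaleR_matrix_vector_assoc[symmetric] matrix_vector_mul_assoc ..

lemma edge_operator_arc:
  fixes p :: "('d::finite, 'n::finite) config" and x :: "real ^ ('n set)"
  assumes "simple_graph E" "orientation E A" "(i, h) \<in> A"
  defines "y \<equiv> block (transpose (directed_rigidity_matrix E A p) *v x)"
  shows "(edge_operator E A p *v x) $ {i, h} = 2 * ((p $ i - p $ h) \<bullet> (y $ i - y $ h))"
proof -
  have "flatten y = transpose (directed_rigidity_matrix E A p) *v x"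
    unfolding y_def by (rule flatten_block)
  then show ?thesis
    using rigidity_matrix_apply[of i h E p y] orientation_arc[OF assms(1-3)]
    by (simp add: edge_operator_apply del: transpose_matrix_vector)
qed

text \<open>
  The equations for \<open>a\<close> and \<open>b\<close> are the real and imaginary part of
  \<open>D (Z v) = (\<alpha> + \<i> \<beta>) D v\<close> for \<open>v = a + \<i> b\<close>; the real case \<open>\<alpha> = \<beta> = 0\<close>, \<open>b = 0\<close> is used as well.
  The orientation being acyclic, there is a vertex \<open>i\<close> where the force \<open>D v\<close> is non-zero although it
  vanishes at all out-neighbours of \<open>i\<close>. There the equation reads \<open>G (y + \<i> z) = (\<alpha> + \<i> \<beta>) (y + \<i> z)\<close>
  for a positive semidefinite \<open>G\<close> that is definite on the span of the outgoing edge vectors, which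
  contains \<open>y\<close> and \<open>z\<close>.
\<close>

lemma edge_operator_force_spectrum:
  fixes E :: "'n::finite set set" and p :: "('d::finite, 'n) config" and a b :: "real ^ ('n set)"
  assumes E: "simple_graph E" and A: "orientation E A" "acyclic A"
  defines "D \<equiv> transpose (directed_rigidity_matrix E A p)" and "Z \<equiv> edge_operator E A p"
  assumes a: "D *v (Z *v a) = \<alpha> *\<^sub>R (D *v a) - \<beta> *\<^sub>R (D *v b)"
    and b: "D *v (Z *v b) = \<alpha> *\<^sub>R (D *v b) + \<beta> *\<^sub>R (D *v a)"
    and nz: "D *v a \<noteq> 0 \<or> D *v b \<noteq> 0"
  shows "\<beta> = 0 \<and> \<alpha> > 0"
proof -
  define force where "force x = block (D *v x)" for x
  have "\<exists>i. force a $ i \<noteq> 0 \<or> force b $ i \<noteq> 0"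
    using nz unfolding force_def by (metis flatten_block vec_eq_iff zero_index linear_0[OF linear_flatten])
  moreover have "wf (A\<inverse>)" using A(2) by (intro finite_acyclic_wf_converse) auto
  ultimately obtain i where i: "force a $ i \<noteq> 0 \<or> force b $ i \<noteq> 0"
    and "\<And>h. (h, i) \<in> A\<inverse> \<Longrightarrow> h \<notin> {i. force a $ i \<noteq> 0 \<or> force b $ i \<noteq> 0}"
    unfolding wf_eq_minimal by (metis (mono_tags, lifting) mem_Collect_eq)
  then have sink: "force a $ h = 0" "force b $ h = 0" if "(i, h) \<in> A" for h
    using that by auto
  define u where "u h = p $ i - p $ h" for h
  define G where "G x = (\<Sum>h | (i, h) \<in> A. (2 * (u h \<bullet> x)) *\<^sub>R u h)" for x
  have G: "force (Z *v x) $ i = G (force x $ i)" if "\<And>h. (i, h) \<in> A \<Longrightarrow> force x $ h = 0" for x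
  proof -
    have "force (Z *v x) $ i = (\<Sum>h | (i, h) \<in> A. (Z *v x) $ {i, h} *\<^sub>R u h)"
      unfolding force_def D_def directed_force[OF E A(1)] u_def ..
    also have "\<dots> = G (force x $ i)"
      unfolding G_def
      by (rule sum.cong) (use that in \<open>auto simp: Z_def edge_operator_arc[OF E A(1)] u_def
          force_def D_def simp del: transpose_matrix_vector\<close>)
    finally show ?thesis .
  qed
  let ?y = "force a $ i" and ?z = "force b $ i"
  have Gy: "G ?y = \<alpha> *\<^sub>R ?y - \<beta> *\<^sub>R ?z"
    using G[of a] sink a by (simp add: force_def linear_diff[OF linear_block] linear_cmul[OF linear_block])
  have Gz: "G ?z = \<alpha> *\<^sub>R ?z + \<beta> *\<^sub>R ?y"
    using G[of b] sink b by (simp add: force_def linear_add[OF linear_block] linear_cmul[OF linear_block])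
  have inner_G: "x \<bullet> G x' = 2 * (\<Sum>h | (i, h) \<in> A. (u h \<bullet> x) * (u h \<bullet> x'))" for x x'
    by (simp add: G_def inner_sum_right sum_distrib_left algebra_simps inner_commute)
  have pos: "?y \<bullet> ?y + ?z \<bullet> ?z > 0"
    using i by (metis add.commute add_pos_nonneg inner_ge_zero inner_gt_zero_iff)
  \<comment> \<open>symmetry of \<open>G\<close> makes the eigenvalue real\<close>
  have "?z \<bullet> G ?y - ?y \<bullet> G ?z = 0"
    unfolding inner_G by (simp add: mult.commute)
  then have "\<beta> * (?y \<bullet> ?y + ?z \<bullet> ?z) = 0"
    unfolding Gy Gz by (simp add: algebra_simps inner_diff_right inner_add_right inner_commute)
  then have \<beta>: "\<beta> = 0" using pos by simp
  have sumsq: "\<alpha> * (?y \<bullet> ?y + ?z \<bullet> ?z) =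
      2 * (\<Sum>h | (i, h) \<in> A. (u h \<bullet> ?y)\<^sup>2) + 2 * (\<Sum>h | (i, h) \<in> A. (u h \<bullet> ?z)\<^sup>2)"
    using inner_G[of ?y ?y] inner_G[of ?z ?z] unfolding Gy Gz
    by (simp add: \<beta> power2_eq_square distrib_left)
  have "\<alpha> \<noteq> 0"
  proof
    assume "\<alpha> = 0"
 have "(\<Sum>h | (i, h) \<in> A. (u h \<bullet> v)\<^sup>2) \<ge> 0" for v
      by (simp add: sum_nonneg)
    from this[of ?y] this[of ?z]
    have "(\<Sum>h | (i, h) \<in> A. (u h \<bullet> ?y)\<^sup>2) = 0" "(\<Sum>h | (i, h) \<in> A. (u h \<bullet> ?z)\<^sup>2) = 0"
      using sumsq \<open>\<alpha> = 0\<close> by auto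
    then have orth: "u h \<bullet> ?y = 0" "u h \<bullet> ?z = 0" if "(i, h) \<in> A" for h
      using that by (auto simp: sum_nonneg_eq_0_iff)
    have "force x $ i \<bullet> v = 0" if "\<And>h. (i, h) \<in> A \<Longrightarrow> u h \<bullet> v = 0" for x v
      unfolding force_def D_def directed_force[OF E A(1)] inner_sum_left
      by (rule sum.neutral) (use that in \<open>auto simp: u_def\<close>)
    then have "?y \<bullet> ?y = 0" "?z \<bullet> ?z = 0" using orth by blast+
    then show False using pos by simp
  qed
  moreover have "\<alpha> * (?y \<bullet> ?y + ?z \<bullet> ?z) \<ge> 0"
    unfolding sumsq by (intro add_nonneg_nonneg mult_nonneg_nonneg sum_nonneg) auto
  then have "\<alpha> \<ge> 0" using pos by (simp add: zero_le_mult_iff)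
  ultimately show ?thesis using \<beta> by simp
qed

lemma eigenvalue_on_real:
  fixes M :: "real ^ 'm::finite ^ 'm"
  shows "eigenvalue_on M W c \<longleftrightarrow> (\<exists>a\<in>W. \<exists>b\<in>W. (a \<noteq> 0 \<or> b \<noteq> 0) \<and>
    M *v a = Re c *\<^sub>R a - Im c *\<^sub>R b \<and> M *v b = Re c *\<^sub>R b + Im c *\<^sub>R a)"
proof -
  have mv: "map_matrix complex_of_real M *v v = c *s v \<longleftrightarrow>
      M *v (\<chi> i. Re (v $ i)) = Re c *\<^sub>R (\<chi> i. Re (v $ i)) - Im c *\<^sub>R (\<chi> i. Im (v $ i)) \<and>
      M *v (\<chi> i. Im (v $ i)) = Re c *\<^sub>R (\<chi> i. Im (v $ i)) + Im c *\<^sub>R (\<chi> i. Re (v $ i))" for v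
    by (auto simp: vec_eq_iff complex_eq_iff matrix_vector_mult_def map_matrix_def)
  show ?thesis
  proof
    assume "eigenvalue_on M W c"
    then obtain v where v: "v \<in> complexification W" "v \<noteq> 0" "map_matrix complex_of_real M *v v = c *s v"
      unfolding eigenvalue_on_def by blast
    have "(\<chi> i. Re (v $ i)) \<noteq> 0 \<or> (\<chi> i. Im (v $ i)) \<noteq> 0"
      using v(2) by (auto simp: vec_eq_iff complex_eq_iff)
    then show "\<exists>a\<in>W. \<exists>b\<in>W. (a \<noteq> 0 \<or> b \<noteq> 0) \<and>
        M *v a = Re c *\<^sub>R a - Im c *\<^sub>R b \<and> M *v b = Re c *\<^sub>R b + Im c *\<^sub>R a"
      using v(1,3) unfolding mv complexification_def by blast
  next
    assume "\<exists>a\<in>W. \<exists>b\<in>W. (a \<noteq> 0 \<or> b \<noteq> 0) \<and>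
        M *v a = Re c *\<^sub>R a - Im c *\<^sub>R b \<and> M *v b = Re c *\<^sub>R b + Im c *\<^sub>R a"
    then obtain a b where ab: "a \<in> W" "b \<in> W" "a \<noteq> 0 \<or> b \<noteq> 0"
      "M *v a = Re c *\<^sub>R a - Im c *\<^sub>R b" "M *v b = Re c *\<^sub>R b + Im c *\<^sub>R a" by blast
    let ?v = "\<chi> i. Complex (a $ i) (b $ i)"
    have "?v \<in> complexification W" "map_matrix complex_of_real M *v ?v = c *s ?v"
      unfolding mv complexification_def using ab by simp_all
    moreover have "?v \<noteq> 0" using ab(3) by (auto simp: vec_eq_iff complex_eq_iff)
    ultimately show "eigenvalue_on M W c" unfolding eigenvalue_on_def by blast
  qed
qed

lemma eigenvalue_on_uminus: 
  fixes M :: "real ^ 'm::finite ^ 'm"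
  shows "eigenvalue_on (- M) W c \<longleftrightarrow> eigenvalue_on M W (- c)"
proof -
  have "- M *v x = - (M *v x)" for x
    by (simp add: vec_eq_iff matrix_vector_mult_def sum_negf)
  then have "- M *v a = Re c *\<^sub>R a - Im c *\<^sub>R b \<longleftrightarrow> M *v a = Re (- c) *\<^sub>R a - Im (- c) *\<^sub>R b"
    "- M *v b = Re c *\<^sub>R b + Im c *\<^sub>R a \<longleftrightarrow> M *v b = Re (- c) *\<^sub>R b + Im (- c) *\<^sub>R a" for a b
    by (auto simp: minus_equation_iff[of "M *v a"] minus_equation_iff[of "M *v b"])
  then show ?thesis unfolding eigenvalue_on_real by simp
qed

text \<open>
  For an eigenvector \<open>v\<close> without forces, \<open>Z v = 0\<close>, so \<open>c = 0\<close>; otherwise applying \<open>D\<^sup>T\<close> to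
  \<open>Z v = c v\<close> gives the equation for the forces that makes \<open>c\<close> positive.
\<close>

lemma edge_operator_eigenvalue:
  assumes "simple_graph E" "orientation E A" "acyclic A"
    and "eigenvalue_on (edge_operator E A p) W c"
  shows "c = 0 \<or> (Im c = 0 \<and> Re c > 0)"
proof -
  let ?Z = "edge_operator E A p" and ?D = "transpose (directed_rigidity_matrix E A p)"
  obtain a b where ab: "a \<noteq> 0 \<or> b \<noteq> 0" "?Z *v a = Re c *\<^sub>R a - Im c *\<^sub>R b"
    "?Z *v b = Re c *\<^sub>R b + Im c *\<^sub>R a"
    using assms(4) unfolding eigenvalue_on_real by blast
  show ?thesis
  proof (cases "?D *v a \<noteq> 0 \<or> ?D *v b \<noteq> 0")
    case True
    have "?D *v (?Z *v a) = Re c *\<^sub>R (?D *v a) - Im c *\<^sub>R (?D *v b)"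
      "?D *v (?Z *v b) = Re c *\<^sub>R (?D *v b) + Im c *\<^sub>R (?D *v a)"
      unfolding ab by (simp_all add: matrix_vector_mult_diff_distrib matrix_vector_right_distrib
          linear_cmul[OF matrix_vector_mul_linear] del: transpose_matrix_vector)
    from edge_operator_force_spectrum[OF assms(1-3) this True] show ?thesis by blast
  next
    case False
    then have "?Z *v a = 0" "?Z *v b = 0"
      unfolding edge_operator_apply by (simp_all del: transpose_matrix_vector)
    then have 0: "Re c * a $ i = Im c * b $ i" "Re c * b $ i = - (Im c * a $ i)" for i
      using ab(2,3) by (auto simp: vec_eq_iff add_eq_0_iff)
    have "((Re c)\<^sup>2 + (Im c)\<^sup>2) * a $ i = 0" "((Re c)\<^sup>2 + (Im c)\<^sup>2) * b $ i = 0" for i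
      using 0[of i] by algebra+
    moreover obtain i where "a $ i \<noteq> 0 \<or> b $ i \<noteq> 0"
      using ab(1) by (auto simp: vec_eq_iff)
    ultimately have "(Re c)\<^sup>2 + (Im c)\<^sup>2 = 0" by (metis mult_eq_0_iff)
    then show ?thesis by (simp add: complex_eq_iff sum_power2_eq_zero_iff)
  qed
qed

lemma force_edge_operator_eq_0:
  assumes "simple_graph E" "orientation E A" "acyclic A"
    and "transpose (directed_rigidity_matrix E A p) *v (edge_operator E A p *v x) = 0"
  shows "transpose (directed_rigidity_matrix E A p) *v x = 0"
  using edge_operator_force_spectrum[OF assms(1-3), of p x 0 0 0] assms(4) by auto

section \<open>Rank of the directed rigidity matrix\<close>

lemma sum_min_plus_choose:
  fixes d n :: nat
  assumes "d \<le> n"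
  shows "(\<Sum>k<n. min d k) + (Suc d choose 2) = d * n"
  using assms
proof (induction n rule: dec_induct)
  case base
  have "(\<Sum>k<d. min d k) = (\<Sum>k<d. k)" by (rule sum.cong) auto
  also have "\<dots> + (Suc d choose 2) = d * d"
    by (induction d) (auto simp: numeral_2_eq_2)
  finally show ?case .
next
  case (step n)
  then show ?case by simp
qed

text \<open>
  Induction removing a vertex without incoming arcs from \<open>V\<close>: this leaves the other
  out-neighbourhoods inside \<open>V\<close> unchanged, and the removed vertex has out-degree less than \<open>card V\<close>.
\<close>

lemma acyclic_outdegree_sum:
  fixes A :: "('n::finite \<times> 'n) set"
  assumes "acyclic A"
  shows "(\<Sum>i\<in>V. min d (card {h \<in> V. (i, h) \<in> A})) \<le> (\<Sum>k<card V. min d k)"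
proof (induction "card V" arbitrary: V)
  case 0
  then show ?case by simp
next
  case (Suc m V)
  have "wf A" using assms by (intro finite_acyclic_wf) auto
  moreover obtain v where "v \<in> V" using Suc.hyps(2) by fastforce
  ultimately obtain i where i: "i \<in> V" "\<And>j. (j, i) \<in> A \<Longrightarrow> j \<notin> V"
    unfolding wf_eq_minimal by metis
  let ?W = "V - {i}"
  have card: "m = card ?W" using Suc.hyps(2) i(1) by simp
  have "(\<Sum>j\<in>V. min d (card {h \<in> V. (j, h) \<in> A})) =
      min d (card {h \<in> V. (i, h) \<in> A}) + (\<Sum>j\<in>?W. min d (card {h \<in> V. (j, h) \<in> A}))"
    using i(1) by (simp add: sum.remove)
  also have "(\<Sum>j\<in>?W. min d (card {h \<in> V. (j, h) \<in> A})) = (\<Sum>j\<in>?W. min d (card {h \<in> ?W. (j, h) \<in> A}))"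
  proof (rule sum.cong)
    fix j assume "j \<in> ?W"
    then have "{h \<in> V. (j, h) \<in> A} = {h \<in> ?W. (j, h) \<in> A}" using i(2) by blast
    then show "min d (card {h \<in> V. (j, h) \<in> A}) = min d (card {h \<in> ?W. (j, h) \<in> A})" by simp
  qed simp
  also have "\<dots> \<le> (\<Sum>k<m. min d k)"
    using Suc.hyps(1)[OF card] card by simp
  also have "card {h \<in> V. (i, h) \<in> A} \<le> m"
    unfolding card by (rule card_mono) (use i in auto)
  then have "min d (card {h \<in> V. (i, h) \<in> A}) \<le> min d m" by simp
  finally show ?case using Suc.hyps(2)[symmetric] by simp
qed

lemma directed_row:
  assumes "simple_graph E" "orientation E A" "(i, h) \<in> A"
  shows "row {i, h} (directed_rigidity_matrix E A p) =
    (\<Sum>k\<in>UNIV. (p $ i - p $ h) $ k *\<^sub>R axis (i, k) 1)"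
proof -
  have ih: "i \<noteq> h" "(h, i) \<notin> A" using orientation_arc[OF assms] by auto
  have "(\<Sum>k\<in>UNIV. (p $ i - p $ h) $ k *\<^sub>R (axis (i, k) 1 :: real ^ _)) $ (l, m) =
      (\<Sum>k\<in>UNIV. if k = m then (if l = i then (p $ i - p $ h) $ m else 0) else 0)" for l m
    unfolding sum_component by (rule sum.cong) (auto simp: axis_def)
  moreover have "row {i, h} (directed_rigidity_matrix E A p) $ (l, m) =
      (if l = i then (p $ i - p $ h) $ m else 0)" for l m
    using ih assms(3) by (auto simp: row_def directed_rigidity_matrix_entry[OF assms(1,2)]
        other_end_eq doubleton_eq_iff)
  ultimately show ?thesis by (simp add: vec_eq_iff split_paired_all)
qed

text \<open>
  The rows of the arcs leaving \<open>i\<close> span a space whose dimension is at most their number and at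
  most \<open>d\<close>, since they are supported in the block of \<open>i\<close>; \<open>T i\<close> is the smaller of the two spanning sets.
\<close>

lemma rank_directed_rigidity_matrix:
  fixes E :: "'n::finite set set" and p :: "('d::finite, 'n) config"
  assumes E: "simple_graph E" and A: "orientation E A" "acyclic A"
    and n: "CARD('d) \<le> CARD('n)"
  shows "rank (directed_rigidity_matrix E A p) + (CARD('d) + 1 choose 2) \<le> CARD('d) * CARD('n)"
proof -
  let ?D = "directed_rigidity_matrix E A p"
  define out where "out i = {h. (i, h) \<in> A}" for i
  define T where "T i = (if card (out i) \<le> CARD('d) then (\<lambda>h. row {i, h} ?D) ` out i
    else range (\<lambda>k. axis (i, k) 1))" for i
  have T: "card (T i) \<le> min CARD('d) (card (out i))" for i
    using card_image_le[of "out i" "\<lambda>h. row {i, h} ?D"]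
      card_image_le[of UNIV "\<lambda>k :: 'd. axis (i, k) (1 :: real)"] by (auto simp: T_def)
  have "rows ?D \<subseteq> span (\<Union>i\<in>UNIV. T i)"
  proof
    fix r assume "r \<in> rows ?D"
    then obtain e where e: "r = row e ?D" by (auto simp: rows_def)
    show "r \<in> span (\<Union>i\<in>UNIV. T i)"
    proof (cases "\<exists>i h. (i, h) \<in> A \<and> e = {i, h}")
      case True
      then obtain i h where ih: "(i, h) \<in> A" "e = {i, h}" by blast
      have "r \<in> span (T i)"
      proof (cases "card (out i) \<le> CARD('d)")
        case True
        then show ?thesis using ih e by (auto simp: T_def out_def intro!: span_base)
      next
        case False
        then show ?thesis
          unfolding e ih(2) directed_row[OF E A(1) ih(1)]
          by (intro span_sum span_scale span_base) (auto simp: T_def)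
      qed
      then show ?thesis by (rule set_mp[OF span_mono, rotated]) auto
    next
      case False
      then have "r = 0"
        unfolding e by (auto simp: vec_eq_iff row_def directed_rigidity_matrix_entry[OF E A(1)])
      then show ?thesis by (simp add: span_zero)
    qed
  qed
  then have "rank ?D \<le> card (\<Union>i\<in>UNIV. T i)"
    unfolding row_rank_def by (rule dim_le_card) (auto simp: T_def)
  also have "\<dots> \<le> (\<Sum>i\<in>UNIV. card (T i))" by (rule card_UN_le) simp
  also have "\<dots> \<le> (\<Sum>i\<in>UNIV. min CARD('d) (card (out i)))" by (intro sum_mono T)
  also have "\<dots> \<le> (\<Sum>k<CARD('n). min CARD('d) k)"
    using acyclic_outdegree_sum[OF A(2), of "CARD('d)" UNIV] by (simp add: out_def)
  finally show ?thesis using sum_min_plus_choose[OF n] by simp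
qed

section \<open>Generic rank of the rigidity matrix\<close>

lemma ex_index:
  "\<exists>f :: 'd::finite \<Rightarrow> nat. bij_betw f UNIV {..<CARD('d)}"
  using ex_bij_betw_finite_nat[of "UNIV :: 'd set"] by (simp add: atLeast0LessThan)

text \<open>
  These pairs index the infinitesimal isometries: \<open>(a, a)\<close> stands for the translation along
  axis \<open>a\<close>, and \<open>(a, b)\<close> for the rotation in the plane of the axes \<open>a\<close> and \<open>b\<close>.
\<close>

lemma card_ordered_pairs:
  fixes f :: "'d::finite \<Rightarrow> nat"
  assumes f: "bij_betw f UNIV {..<CARD('d)}"
  shows "card {(a, b). f a \<le> f b} = (CARD('d) + 1 choose 2)"
proof -
  have inj: "inj f" using f by (simp add: bij_betw_def)
  have "card {a. f a \<le> f b} = Suc (f b)" for b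
  proof -
    have "f ` {a. f a \<le> f b} = {..f b}"
      using f by (auto simp: bij_betw_def image_iff set_eq_iff) (metis lessThan_iff le_less_trans rangeE rangeI)
    then show ?thesis using card_image[OF inj_on_subset[OF inj], of "{a. f a \<le> f b}"] by simp
  qed
  moreover have "{(a, b). f a \<le> f b} = (\<lambda>(b, a). (a, b)) ` (SIGMA b:UNIV. {a. f a \<le> f b})"
    by auto
  moreover have "inj_on (\<lambda>(b, a). (a, b)) (SIGMA b:UNIV. {a. f a \<le> f b})"
    by (auto simp: inj_on_def)
  ultimately have "card {(a, b). f a \<le> f b} = (\<Sum>b\<in>UNIV. Suc (f b))"
    by (simp add: card_image)
  also have "\<dots> = (\<Sum>k<CARD('d). Suc k)"
    using sum.reindex_bij_betw[OF f, of Suc] .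
  also have "\<dots> = (CARD('d) + 1 choose 2)"
  proof -
    have "(\<Sum>k<m. Suc k) = (m + 1 choose 2)" for m
      by (induction m) (simp_all add: numeral_2_eq_2)
    then show ?thesis .
  qed
  finally show ?thesis .
qed

text \<open>
  The vertices \<open>\<iota> a\<close> sit at the unit vectors and all others at the origin. One such
  configuration suffices to certify the generic rank bounds in both directions.
\<close>

definition simplex_config :: "('d::finite \<Rightarrow> 'n::finite) \<Rightarrow> ('d, 'n) config" where
  "simplex_config \<iota> = (\<chi> i k. if i = \<iota> k then 1 else 0)"

lemma simplex_config_vertex: "inj \<iota> \<Longrightarrow> simplex_config \<iota> $ \<iota> a $ k = (if k = a then 1 else 0)"
  by (auto simp: simplex_config_def inj_def)

lemma simplex_config_diff:
  assumes "inj \<iota>"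
  shows "(simplex_config \<iota> $ \<iota> a - simplex_config \<iota> $ \<iota> b) \<bullet> x = x $ a - x $ b"
    and "i \<notin> range \<iota> \<Longrightarrow> (simplex_config \<iota> $ i - simplex_config \<iota> $ \<iota> a) \<bullet> x = - (x $ a)"
proof -
  have 1: "simplex_config \<iota> $ \<iota> a = axis a 1" for a
    by (simp add: vec_eq_iff axis_def simplex_config_vertex[OF assms])
  show "(simplex_config \<iota> $ \<iota> a - simplex_config \<iota> $ \<iota> b) \<bullet> x = x $ a - x $ b"
    by (simp add: 1 inner_diff_left inner_axis_axis inner_axis')
  assume "i \<notin> range \<iota>"
  then have "simplex_config \<iota> $ i = 0" by (auto simp: vec_eq_iff simplex_config_def)
  then show "(simplex_config \<iota> $ i - simplex_config \<iota> $ \<iota> a) \<bullet> x = - (x $ a)"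
    by (simp add: 1 inner_diff_left inner_axis')
qed

text \<open>
  A flex \<open>w\<close> is determined by the coordinates \<open>w $ \<iota> a $ b\<close> with \<open>f a \<le> f b\<close>: the edges between
  unit vectors determine the remaining coordinates of the vertices \<open>\<iota> a\<close>, and the edges from
  the origin those of all other vertices.
\<close>

lemma dim_flexes_simplex_config:
  fixes \<iota> :: "'d::finite \<Rightarrow> 'n::finite"
  assumes \<iota>: "inj \<iota>"
  shows "dim (flexes {e. card e = 2} (simplex_config \<iota>)) \<le> (CARD('d) + 1 choose 2)"
proof -
  obtain f :: "'d \<Rightarrow> nat" where f: "bij_betw f UNIV {..<CARD('d)}" using ex_index by blast
  let ?p = "simplex_config \<iota>" and ?K = "{e :: 'n set. card e = 2}"
  define T where "T = {(a, b). f a \<le> f b}"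
  define \<phi> :: "('d, 'n) config \<Rightarrow> real ^ ('d \<times> 'd)" where
    "\<phi> w = (\<chi> c. if c \<in> T then w $ \<iota> (fst c) $ snd c else 0)" for w
  have lin: "linear \<phi>" by (auto intro!: linearI simp: \<phi>_def vec_eq_iff)
  have K: "simple_graph ?K" by (simp add: simple_graph_def)
  have sub: "subspace (flexes ?K ?p)"
    unfolding flexes_def using linear_compose[OF linear_flatten matrix_vector_mul_linear]
    by (intro linear_subspace_kernel) (simp add: o_def)
  have "w = 0" if w: "w \<in> flexes ?K ?p" and 0: "\<phi> w = 0" for w
  proof -
    have flex: "(?p $ i - ?p $ j) \<bullet> (w $ i - w $ j) = 0" if "i \<noteq> j" for i j
      using w that unfolding flexes_iff[OF K] by (simp add: card_2_iff')
    have up: "w $ \<iota> a $ b = 0" if "f a \<le> f b" for a b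
    proof -
      have "\<phi> w $ (a, b) = 0" using 0 by simp
      then show ?thesis using that by (simp add: \<phi>_def T_def)
    qed
    have vert: "w $ \<iota> a $ b = 0" for a b
    proof (cases "f a \<le> f b")
      case False
      then have "\<iota> a \<noteq> \<iota> b" using inj_eq[OF \<iota>] by auto
      from flex[OF this] have "(w $ \<iota> a - w $ \<iota> b) $ a - (w $ \<iota> a - w $ \<iota> b) $ b = 0"
        unfolding simplex_config_diff(1)[OF \<iota>] .
      then show ?thesis using up[of a a] up[of b b] up[of b a] False by simp
    qed (rule up)
    have "w $ i $ a = 0" for i a
    proof (cases "i \<in> range \<iota>")
      case False
      then have "i \<noteq> \<iota> a" by blast
      from flex[OF this] show ?thesis
        unfolding simplex_config_diff(2)[OF \<iota> False] by (simp add: vert)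
    qed (auto simp: vert)
    then show ?thesis by (simp add: vec_eq_iff)
  qed
  then have "inj_on \<phi> (flexes ?K ?p)"
    using linear_injective_on_subspace_0[OF lin sub] by blast
  then have "dim (flexes ?K ?p) = dim (\<phi> ` flexes ?K ?p)"
    using dim_image_eq[OF lin] sub by (simp add: span_eq_iff[THEN iffD2])
  also have "\<dots> \<le> dim {x :: real ^ ('d \<times> 'd). \<forall>c. c \<notin> T \<longrightarrow> x $ c = 0}"
    by (rule dim_subset) (auto simp: \<phi>_def)
  also have "\<dots> = card T"
    using dim_substandard_cart[where 'a = real and d = T] unfolding dim_vec_eq by simp
  finally show ?thesis using card_ordered_pairs[OF f] by (simp add: T_def)
qed

text \<open>
  Row \<open>(a, a)\<close> is a translation and row \<open>(a, b)\<close> with \<open>f a < f b\<close> a rotation; the rows with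
  \<open>f b < f a\<close>, which would repeat the rotations with opposite sign, are set to zero.
\<close>

definition trivial_motions ::
    "('d \<Rightarrow> nat) \<Rightarrow> ('d::finite, 'n::finite) config \<Rightarrow> real ^ ('n \<times> 'd) ^ ('d \<times> 'd)" where
  "trivial_motions f p = (\<chi> c. case c of (a, b) \<Rightarrow> flatten (\<chi> i k.
     if a = b then (if k = a then 1 else 0)
     else if f a < f b then (if k = b then p $ i $ a else 0) - (if k = a then p $ i $ b else 0)
     else 0))"

lemma rigidity_matrix_trivial_motions:
  assumes "simple_graph E"
  shows "rigidity_matrix E p *v row c (trivial_motions f p) = 0"
proof -
  obtain a b where c: "c = (a, b)" by fastforce
  define w where "w = block (row c (trivial_motions f p))"
  have w: "w $ i $ k = (if a = b then (if k = a then 1 else 0)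
     else if f a < f b then (if k = b then p $ i $ a else 0) - (if k = a then p $ i $ b else 0)
     else 0)" for i k
    by (simp add: w_def c row_def trivial_motions_def block_flatten)
  have "w \<in> flexes E p"
    unfolding flexes_iff[OF assms]
  proof (intro allI impI)
    fix i j
    show "(p $ i - p $ j) \<bullet> (w $ i - w $ j) = 0"
    proof (cases "a \<noteq> b \<and> f a < f b")
      case True
      then have "w $ i - w $ j = (p $ i - p $ j) $ a *\<^sub>R axis b 1 - (p $ i - p $ j) $ b *\<^sub>R axis a 1"
        by (auto simp: vec_eq_iff w axis_def)
      then show ?thesis by (simp add: inner_diff_right inner_axis)
    next
      case False
      then have "w $ i - w $ j = 0" by (auto simp: vec_eq_iff w)
      then show ?thesis by simp
    qed
  qed
  then show ?thesis by (simp add: flexes_def w_def flatten_block)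
qed

lemma rank_trivial_motions_simplex_config:
  fixes \<iota> :: "'d::finite \<Rightarrow> 'n::finite"
  assumes \<iota>: "inj \<iota>" and f: "bij_betw f UNIV {..<CARD('d)}"
  shows "(CARD('d) + 1 choose 2) \<le> rank (trivial_motions f (simplex_config \<iota>))"
proof -
  have inj: "f a = f b \<longleftrightarrow> a = b" for a b using f by (auto simp: bij_betw_def inj_on_def)
  let ?M = "trivial_motions f (simplex_config \<iota>)"
  have M: "?M $ (a, b) $ (\<iota> k, l) = (if a = b then (if l = a then 1 else 0)
     else if f a < f b then (if l = b \<and> a = k then 1 else 0) - (if l = a \<and> b = k then 1 else 0)
     else 0)" for a b k l
    using simplex_config_vertex[OF \<iota>] by (simp add: trivial_motions_def flatten_def)
  have "card {(a, b). f a \<le> f b} \<le> rank ?M"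
  proof (rule card_le_rank)
    fix x :: "real ^ ('d \<times> 'd)"
    assume supp: "\<And>c. c \<notin> {(a, b). f a \<le> f b} \<Longrightarrow> x $ c = 0" and 0: "transpose ?M *v x = 0"
    have eq: "(\<Sum>c\<in>{(l, l), (k, l), (l, k)}. ?M $ c $ (\<iota> k, l) * x $ c) = 0" for k l
    proof -
      have "0 = (transpose ?M *v x) $ (\<iota> k, l)" using 0 by simp
      also have "\<dots> = (\<Sum>c\<in>UNIV. ?M $ c $ (\<iota> k, l) * x $ c)"
        by (simp add: matrix_vector_mult_def transpose_def del: transpose_matrix_vector)
      also have "\<dots> = (\<Sum>c\<in>{(l, l), (k, l), (l, k)}. ?M $ c $ (\<iota> k, l) * x $ c)"
        by (rule sum.mono_neutral_right) (auto simp: M split: if_splits)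
      finally show ?thesis by simp
    qed
    have diag: "x $ (l, l) = 0" for l
      using eq[of l l] by (simp add: M)
    have "x $ (k, l) = 0" if "f k < f l" for k l
    proof -
      have "k \<noteq> l" using that by auto
      then show ?thesis using eq[of k l] that diag[of l] by (simp add: M)
    qed
    then have "x $ (k, l) = 0" for k l
      using supp[of "(k, l)"] diag inj by (cases "f k < f l"; cases "f k = f l") auto
    then show "x = 0" by (simp add: vec_eq_iff split_paired_all)
  qed
  then show ?thesis using card_ordered_pairs[OF f] by simp
qed

text \<open>
  The infinitesimal isometries lie in the kernel of the rigidity matrix at every
  configuration; they are independent at \<open>simplex_config\<close>, hence generically, their coordinates being polynomial
  in the configuration.
\<close>

lemma for_generic_rank_upper:
  fixes E :: "'n::finite set set"
  assumes "CARD('d::finite) \<le> CARD('n)" and E: "simple_graph E"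
  shows "for_generic (\<lambda>p :: ('d, 'n) config.
    rank (rigidity_matrix E p) + (CARD('d) + 1 choose 2) \<le> CARD('d) * CARD('n))"
proof -
  obtain f :: "'d \<Rightarrow> nat" where f: "bij_betw f UNIV {..<CARD('d)}" using ex_index by blast
  obtain \<iota> :: "'d \<Rightarrow> 'n" where \<iota>: "inj \<iota>"
    using card_le_inj[of "UNIV :: 'd set" "UNIV :: 'n set"] assms(1) by auto
  have entry: "rat_polynomial_function (\<lambda>p :: ('d, 'n) config. trivial_motions f p $ c $ x)" for c x
  proof -
    obtain a b i k where "c = (a, b)" "x = (i, k)" by (metis surj_pair)
    then show ?thesis
      by (cases "a = b"; cases "f a < f b"; cases "k = a"; cases "k = b")
        (auto simp: trivial_motions_def flatten_def intro!: rat_polynomial_diff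
          rat_polynomial_uminus rat_polynomial_0 rat_polynomial_1 rat_polynomial_function.coord)
  qed
  show ?thesis
  proof (rule for_generic_mono[OF for_generic_rank_ge[of "trivial_motions f" "simplex_config \<iota>", OF entry]])
    fix p :: "('d, 'n) config"
    assume "rank (trivial_motions f (simplex_config \<iota>)) \<le> rank (trivial_motions f p)"
    then have "(CARD('d) + 1 choose 2) \<le> rank (trivial_motions f p)"
      using rank_trivial_motions_simplex_config[OF \<iota> f] by simp
    also have "\<dots> \<le> dim {y. rigidity_matrix E p *v y = 0}"
      unfolding row_rank_def
      by (rule dim_subset) (auto simp: rows_def rigidity_matrix_trivial_motions[OF E])
    finally show "rank (rigidity_matrix E p) + (CARD('d) + 1 choose 2) \<le> CARD('d) * CARD('n)"
      using rank_nullity[of "rigidity_matrix E p"] by (simp add: mult.commute)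
  qed
qed

lemma for_generic_dim_flexes_le:
  fixes p0 :: "('d::finite, 'n::finite) config"
  shows "for_generic (\<lambda>p :: ('d, 'n) config. dim (flexes E p) \<le> dim (flexes E p0))"
proof -
  have "rat_polynomial_function (\<lambda>p :: ('d, 'n) config. rigidity_matrix E p $ e $ c)" for e c
  proof -
    obtain i k where "c = (i, k)" by (metis surj_pair)
    then show ?thesis
      by (cases "e \<in> E \<and> i \<in> e")
        (auto simp: rigidity_matrix_def intro!: rat_polynomial_diff rat_polynomial_0
          rat_polynomial_function.coord)
  qed
  note generic = for_generic_rank_ge[of "rigidity_matrix E" p0, OF this]
  show ?thesis
  proof (rule for_generic_mono[OF generic])
    fix p :: "('d, 'n) config"
    assume "rank (rigidity_matrix E p0) \<le> rank (rigidity_matrix E p)"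
    then show "dim (flexes E p) \<le> dim (flexes E p0)"
      using dim_flexes[of E p] dim_flexes[of E p0] by linarith
  qed
qed

text \<open>
  It is enough to find one configuration with at most \<open>(d+1 choose 2)\<close> independent flexes. A
  configuration minimising the dimension of the flex space within a Zariski open set of
  rigid ones has locally maximal rank, so all its flexes are flexes of the complete graph.
\<close>

lemma for_generic_rank_lower:
  fixes E :: "'n::finite set set"
  assumes "CARD('d::finite) \<le> CARD('n)" and E: "simple_graph E"
    and rigid: "generically_rigid TYPE('d) E"
  shows "for_generic (\<lambda>p :: ('d, 'n) config.
    CARD('d) * CARD('n) \<le> rank (rigidity_matrix E p) + (CARD('d) + 1 choose 2))"
proof -
  let ?K = "{e :: 'n set. card e = 2}"
  obtain \<iota> :: "'d \<Rightarrow> 'n" where \<iota>: "inj \<iota>"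
    using card_le_inj[of "UNIV :: 'd set" "UNIV :: 'n set"] assms(1) by auto
  obtain f p0 where f: "rat_polynomial_function f" "f p0 \<noteq> 0"
    and good: "\<And>p :: ('d, 'n) config. f p \<noteq> 0 \<Longrightarrow>
      (\<exists>\<epsilon>>0. \<forall>q. dist q p < \<epsilon> \<and> distance_map E q = distance_map E p \<longrightarrow> congruent_config p q) \<and>
      dim (flexes ?K p) \<le> dim (flexes ?K (simplex_config \<iota>))"
    using for_generic_conj[OF rigid[unfolded generically_rigid_def]
        for_generic_dim_flexes_le[of ?K "simplex_config \<iota>"]]
    unfolding for_generic_iff_polynomial by blast
  have "open {p. f p \<noteq> 0}"
    by (intro open_Collect_neq rat_polynomial_continuous f continuous_on_const)
  moreover obtain p1 where p1: "f p1 \<noteq> 0" "\<And>q. f q \<noteq> 0 \<Longrightarrow> dim (flexes E p1) \<le> dim (flexes E q)"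
    using ex_has_least_nat[of "\<lambda>p. f p \<noteq> 0" p0 "\<lambda>p. dim (flexes E p)"] f(2) by blast
  moreover obtain \<delta> where "\<delta> > 0"
    "\<And>q. dist q p1 < \<delta> \<Longrightarrow> distance_map E q = distance_map E p1 \<Longrightarrow> congruent_config p1 q"
    using good[OF p1(1)] by blast
  ultimately have "flexes E p1 \<subseteq> flexes ?K p1"
    by (intro rigid_imp_flexes_complete[OF E, of "{p. f p \<noteq> 0}"]) auto
  then have "dim (flexes E p1) \<le> dim (flexes ?K p1)" by (rule dim_subset)
  also have "\<dots> \<le> (CARD('d) + 1 choose 2)"
    using good[OF p1(1)] dim_flexes_simplex_config[OF \<iota>] by simp
  finally have dim1: "dim (flexes E p1) \<le> (CARD('d) + 1 choose 2)" .
  show ?thesis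
  proof (rule for_generic_mono[OF for_generic_dim_flexes_le[of E p1]])
    fix p :: "('d, 'n) config" assume "dim (flexes E p) \<le> dim (flexes E p1)"
    then show "CARD('d) * CARD('n) \<le> rank (rigidity_matrix E p) + (CARD('d) + 1 choose 2)"
      using dim1 dim_flexes[of E p] by linarith
  qed
qed

section \<open>Equivalence of the admissibility conditions\<close>

lemma edge_operator_range_subset: "range ((*v) (edge_operator E A p)) \<subseteq> rigidity_image E p"
  unfolding rigidity_image_def edge_operator_apply
  by (auto simp: linear_cmul[OF matrix_vector_mul_linear, symmetric] simp del: transpose_matrix_vector)

lemma subspace_rigidity_image: "subspace (rigidity_image E p)"
  unfolding rigidity_image_def by (intro linear_subspace_image matrix_vector_mul_linear subspace_UNIV)

lemma linear_bij_betw_subspace_iff: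
  fixes f :: "'a::euclidean_space \<Rightarrow> 'a"
  assumes "linear f" "subspace W" "f ` W \<subseteq> W"
  shows "bij_betw f W W \<longleftrightarrow> (\<forall>x\<in>W. f x = 0 \<longrightarrow> x = 0)"
proof -
  have "f ` W = W" if "inj_on f W"
  proof (rule subspace_dim_equal)
    have "dim (f ` W) = dim W"
      using that assms by (intro dim_image_eq) (simp_all add: span_eq_iff[THEN iffD2])
    then show "dim W \<le> dim (f ` W)" by simp
  qed (use assms in \<open>auto simp: linear_subspace_image\<close>)
  then show ?thesis
    unfolding bij_betw_def using linear_injective_on_subspace_0[OF assms(1,2)] by blast
qed

lemma edge_operator_bij_iff:
  "bij_betw ((*v) (edge_operator E A p)) (rigidity_image E p) (rigidity_image E p) \<longleftrightarrow>
    (\<forall>x\<in>rigidity_image E p. edge_operator E A p *v x = 0 \<longrightarrow> x = 0)"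
  by (rule linear_bij_betw_subspace_iff)
    (use edge_operator_range_subset[of E A p] in \<open>auto simp: subspace_rigidity_image\<close>)

lemma edge_operator_bij_iff_eigenvalues:
  assumes "simple_graph E" "orientation E A" "acyclic A"
  shows "bij_betw ((*v) (edge_operator E A p)) (rigidity_image E p) (rigidity_image E p) \<longleftrightarrow>
    (\<forall>c. eigenvalue_on (edge_operator E A p) (rigidity_image E p) c \<longrightarrow> Re c \<noteq> 0)"
  unfolding edge_operator_bij_iff
proof (intro iffI allI impI ballI)
  fix c
  assume inj: "\<forall>x\<in>rigidity_image E p. edge_operator E A p *v x = 0 \<longrightarrow> x = 0"
    and c: "eigenvalue_on (edge_operator E A p) (rigidity_image E p) c"
  have "c \<noteq> 0" using c inj unfolding eigenvalue_on_real by force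
  then show "Re c \<noteq> 0" using edge_operator_eigenvalue[OF assms c] by auto
next
  fix x
  assume eig: "\<forall>c. eigenvalue_on (edge_operator E A p) (rigidity_image E p) c \<longrightarrow> Re c \<noteq> 0"
    and x: "x \<in> rigidity_image E p" "edge_operator E A p *v x = 0"
  show "x = 0"
  proof (rule ccontr)
    assume "x \<noteq> 0"
    then have "eigenvalue_on (edge_operator E A p) (rigidity_image E p) 0"
      unfolding eigenvalue_on_real
      by (intro bexI[of _ x] bexI[of _ 0]) (use x subspace_0[OF subspace_rigidity_image] in auto)
    then show False using eig by fastforce
  qed
qed

lemma edge_operator_eigenvalues_iff_hurwitz:
  assumes "simple_graph E" "orientation E A" "acyclic A"
  shows "(\<forall>c. eigenvalue_on (edge_operator E A p) W c \<longrightarrow> Re c \<noteq> 0) \<longleftrightarrow>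
    hurwitz_on (- edge_operator E A p) W"
  unfolding hurwitz_on_def eigenvalue_on_uminus
proof (intro iffI allI impI)
  fix c assume "\<forall>c. eigenvalue_on (edge_operator E A p) W c \<longrightarrow> Re c \<noteq> 0"
    and "eigenvalue_on (edge_operator E A p) W (- c)"
  then show "Re c < 0"
    using edge_operator_eigenvalue[OF assms, of p W "- c"] by fastforce
next
  fix c assume *: "\<forall>c. eigenvalue_on (edge_operator E A p) W (- c) \<longrightarrow> Re c < 0"
    and "eigenvalue_on (edge_operator E A p) W c"
  then show "Re c \<noteq> 0" using spec[OF *, of "- c"] by simp
qed

text \<open>
  The rank hypotheses give \<open>im Z = im R\<close> and, since \<open>rk D \<le> rk Z\<close> by the count for acyclic
  orientations, \<open>ker Z = ker D\<^sup>T\<close>. If \<open>Z (Z x) = 0\<close>, then \<open>D\<^sup>T Z x = 0\<close>, so \<open>D\<^sup>T x = 0\<close> by positivity and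
  \<open>Z x = 0\<close>.
\<close>

lemma edge_operator_full_rank_imp_bij:
  fixes E :: "'n::finite set set" and p :: "('d::finite, 'n) config"
  assumes E: "simple_graph E" and A: "orientation E A" "acyclic A"
    and n: "CARD('d) \<le> CARD('n)"
    and Z: "rank (edge_operator E A p) + (CARD('d) + 1 choose 2) = CARD('d) * CARD('n)"
    and R: "rank (rigidity_matrix E p) + (CARD('d) + 1 choose 2) \<le> CARD('d) * CARD('n)"
  shows "bij_betw ((*v) (edge_operator E A p)) (rigidity_image E p) (rigidity_image E p)"
proof -
  let ?Z = "edge_operator E A p" and ?D = "transpose (directed_rigidity_matrix E A p)"
  have image: "range ((*v) ?Z) = rigidity_image E p"
    by (intro subspace_dim_equal linear_subspace_image matrix_vector_mul_linear subspace_UNIV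
        subspace_rigidity_image edge_operator_range_subset)
      (use Z R in \<open>simp add: rigidity_image_def rank_dim_range[symmetric]\<close>)
  have kernel: "{x. ?D *v x = 0} = {x. ?Z *v x = 0}"
  proof (rule subspace_dim_equal)
    have "rank ?D \<le> rank ?Z"
      using rank_directed_rigidity_matrix[OF E A n, of p] Z by (simp add: rank_transpose)
    then show "dim {x. ?Z *v x = 0} \<le> dim {x. ?D *v x = 0}"
      using rank_nullity[of ?Z] rank_nullity[of ?D] by linarith
    show "{x. ?D *v x = 0} \<subseteq> {x. ?Z *v x = 0}"
      by (auto simp: edge_operator_apply simp del: transpose_matrix_vector)
  qed (rule linear_subspace_kernel[OF matrix_vector_mul_linear])+
  show ?thesis
    unfolding edge_operator_bij_iff
  proof (intro ballI impI)
    fix z assume "z \<in> rigidity_image E p" and Zz: "?Z *v z = 0"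
    then obtain x where x: "z = ?Z *v x" using image by blast
    have "?D *v (?Z *v x) = 0" using Zz kernel unfolding x by blast
    from force_edge_operator_eq_0[OF E A this] show "z = 0" using kernel unfolding x by blast
  qed
qed

lemma rank_edge_operator_of_bij:
  assumes "bij_betw ((*v) (edge_operator E A p)) (rigidity_image E p) (rigidity_image E p)"
  shows "rank (edge_operator E A p) = rank (rigidity_matrix E p)"
proof -
  have "range ((*v) (edge_operator E A p)) = rigidity_image E p"
    using assms edge_operator_range_subset[of E A p] unfolding bij_betw_def by blast
  then show ?thesis by (simp add: rank_dim_range rigidity_image_def)
qed

theorem mainTheorem5:
  fixes E :: "'n::finite set set" and A :: "('n \<times> 'n) set"
  assumes "CARD('d::finite) \<le> CARD('n)"
    and "simple_graph E"
    and "generically_rigid TYPE('d) E"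
    and "orientation E A"
    and "acyclic A"
  shows "(weakly_admissible TYPE('d) E A \<longleftrightarrow> admissible TYPE('d) E A)
    \<and> (admissible TYPE('d) E A \<longleftrightarrow> strongly_admissible TYPE('d) E A)
    \<and> (strongly_admissible TYPE('d) E A \<longleftrightarrow>
        for_generic (\<lambda>p :: ('d, 'n) config. hurwitz_on (- edge_operator E A p) (rigidity_image E p)))"
proof -
  note upper = for_generic_rank_upper[OF assms(1,2)]
  note lower = for_generic_rank_lower[OF assms(1-3)]
  have rank_iff: "int r = int (CARD('d) * CARD('n)) - int ((CARD('d) + 1) choose 2) \<longleftrightarrow>
      r + (CARD('d) + 1 choose 2) = CARD('d) * CARD('n)" for r
    by linarith
  have "weakly_admissible TYPE('d) E A \<longleftrightarrow> admissible TYPE('d) E A"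
    unfolding weakly_admissible_def admissible_def rank_iff
  proof
    assume "for_generic (\<lambda>p :: ('d, 'n) config.
      rank (edge_operator E A p) + (CARD('d) + 1 choose 2) = CARD('d) * CARD('n))"
    from for_generic_conj[OF this upper]
    show "for_generic (\<lambda>p :: ('d, 'n) config.
      bij_betw ((*v) (edge_operator E A p)) (rigidity_image E p) (rigidity_image E p))"
      by (rule for_generic_mono) (use edge_operator_full_rank_imp_bij[OF assms(2,4,5,1)] in blast)
  next
    assume "for_generic (\<lambda>p :: ('d, 'n) config.
      bij_betw ((*v) (edge_operator E A p)) (rigidity_image E p) (rigidity_image E p))"
    from for_generic_conj[OF this for_generic_conj[OF upper lower]]
    show "for_generic (\<lambda>p :: ('d, 'n) config.
      rank (edge_operator E A p) + (CARD('d) + 1 choose 2) = CARD('d) * CARD('n))"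
      by (rule for_generic_mono) (auto simp: rank_edge_operator_of_bij)
  qed
  then show ?thesis
    unfolding admissible_def strongly_admissible_def
      edge_operator_bij_iff_eigenvalues[OF assms(2,4,5)]
      edge_operator_eigenvalues_iff_hurwitz[OF assms(2,4,5)] by blast
qed

end
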